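(* Under Assumptions 1 and 2 (stated in the context), in the single-channel case $Q_2=Q_\infty=:Q$, $R_2=R_\infty=:R$, the function $J_{\mathrm{mix}}$ has a unique stationary point in $\mathcal{K}_\beta$, given by $K=-R^{-1}B^{\mathsf T}P$, where $P$ is the stabilizing solution of the Riccati equation $A^{\mathsf T}P+PA+P(\beta^{-2}W-BR^{-1}B^{\mathsf T})P+Q=0$ (i.e. $A+(\beta^{-2}W-BR^{-1}B^{\mathsf T})P$ is Hurwitz).
   Context: Let $A\in\mathbb{R}^{n\times n}$, $B\in\mathbb{R}^{n\times m}$, $B_w\in\mathbb{R}^{n\times n}$, $W:=B_wB_w^{\mathsf T}$. Let $Q$, $R$ be symmetric positive definite weights and $\beta>0$. For $K\in\mathbb{R}^{m\times n}$ write $A_K:=A+BK$, $S_K:=Q+K^{\mathsf T}RK$. Let $\mathcal{K}:=\{K: A_K \text{ Hurwitz}\}$, $\mathbf{T}_\infty(K)(s)=\begin{bmatrix}Q^{1/2}\\ R^{1/2}K\end{bmatrix}(sI-A_K)^{-1}B_w$, $\mathcal{K}_\beta:=\{K\in\mathcal{K}:\|\mathbf{T}_\infty(K)\|_{\mathcal{H}_\infty}<\beta\}$. For $K\in\mathcal{K}_\beta$ the Riccati equation $A_KX+XA_K^{\mathsf T}+\beta^{-2}XS_KX+W=0$ has a unique stabilizing solution $X_K\succeq0$ (i.e. $A_K+\beta^{-2}X_KS_K$ Hurwitz), and $J_{\mathrm{mix}}(K):=\operatorname{tr}((Q+K^{\mathsf T}RK)X_K)$; a stationary point is $K\in\mathcal{K}_\beta$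 with $\nabla J_{\mathrm{mix}}(K)=0$. Assumption 1: $(A,B)$ stabilizable, $(Q^{1/2},A)$ detectable, and $\beta>\inf_{K\in\mathcal{K}}\|\mathbf{T}_\infty(K)\|_{\mathcal{H}_\infty}$. Assumption 2: $W\succ0$ (together with $Q,R\succ0$). *)

theory Defs
  imports "HOL-Analysis.Analysis"
begin

definition cmat :: "real^'c^'r \<Rightarrow> complex^'c^'r" where
  "cmat M = (\<chi> i j. complex_of_real (M $ i $ j))"

definition hurwitz :: "real^'n^'n \<Rightarrow> bool" where
  "hurwitz M \<longleftrightarrow> (\<forall>z::complex. det (mat z - cmat M) = 0 \<longrightarrow> Re z < 0)"

definition sym_mat :: "real^'n^'n \<Rightarrow> bool" where
  "sym_mat M \<longleftrightarrow> transpose M = M"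

definition pos_def :: "real^'n^'n \<Rightarrow> bool" where
  "pos_def M \<longleftrightarrow> sym_mat M \<and> (\<forall>x. x \<noteq> 0 \<longrightarrow> x \<bullet> (M *v x) > 0)"

definition pos_semidef :: "real^'n^'n \<Rightarrow> bool" where
  "pos_semidef M \<longleftrightarrow> sym_mat M \<and> (\<forall>x. x \<bullet> (M *v x) \<ge> 0)"

definition mat_sqrt :: "real^'n^'n \<Rightarrow> real^'n^'n" where
  "mat_sqrt M = (THE S. pos_semidef S \<and> S ** S = M)"

definition stabilizable :: "real^'n^'n \<Rightarrow> real^'m^'n \<Rightarrow> bool" where
  "stabilizable A B \<longleftrightarrow> (\<exists>K::real^'n^'m. hurwitz (A + B ** K))"

definition detectable :: "real^'n^'p \<Rightarrow> real^'n^'n \<Rightarrow> bool" where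
  "detectable C A \<longleftrightarrow> (\<exists>L::real^'p^'n. hurwitz (A + L ** C))"

definition closed_loop :: "real^'n^'n \<Rightarrow> real^'m^'n \<Rightarrow> real^'n^'m \<Rightarrow> real^'n^'n" where
  "closed_loop A B K = A + B ** K"

definition S_mat :: "real^'n^'n \<Rightarrow> real^'m^'m \<Rightarrow> real^'n^'m \<Rightarrow> real^'n^'n" where
  "S_mat Q R K = Q + transpose K ** R ** K"

text \<open>Transfer matrix T_inf(K)(s) = [Q^(1/2); R^(1/2) K] (sI - A_K)^(-1) B_w, whose output
  index set is the disjoint sum 'n + 'm (stacked outputs).\<close>
definition T_inf ::
  "real^'n^'n \<Rightarrow> real^'m^'n \<Rightarrow> real^'n^'n \<Rightarrow> real^'n^'n \<Rightarrow> real^'m^'m \<Rightarrow> real^'n^'m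
     \<Rightarrow> complex \<Rightarrow> complex^'n^('n + 'm)" where
  "T_inf A B Bw Q R K s =
     (let C = (\<chi> i. case i of Inl j \<Rightarrow> mat_sqrt Q $ j | Inr j \<Rightarrow> (mat_sqrt R ** K) $ j)
                :: real^'n^('n + 'm)
      in cmat C ** matrix_inv (mat s - cmat (closed_loop A B K)) ** cmat Bw)"

definition hinf_norm ::
  "real^'n^'n \<Rightarrow> real^'m^'n \<Rightarrow> real^'n^'n \<Rightarrow> real^'n^'n \<Rightarrow> real^'m^'m \<Rightarrow> real^'n^'m \<Rightarrow> real" where
  "hinf_norm A B Bw Q R K =
     (SUP \<omega>::real. onorm (\<lambda>v::complex^'n. T_inf A B Bw Q R K (\<i> * complex_of_real \<omega>) *v v))"

definition stab_set :: "real^'n^'n \<Rightarrow> real^'m^'n \<Rightarrow> (real^'n^'m) set" where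
  "stab_set A B = {K. hurwitz (closed_loop A B K)}"

definition K_beta ::
  "real^'n^'n \<Rightarrow> real^'m^'n \<Rightarrow> real^'n^'n \<Rightarrow> real^'n^'n \<Rightarrow> real^'m^'m \<Rightarrow> real
     \<Rightarrow> (real^'n^'m) set" where
  "K_beta A B Bw Q R \<beta> = {K \<in> stab_set A B. hinf_norm A B Bw Q R K < \<beta>}"

definition X_sol ::
  "real^'n^'n \<Rightarrow> real^'m^'n \<Rightarrow> real^'n^'n \<Rightarrow> real^'n^'n \<Rightarrow> real^'m^'m \<Rightarrow> real
     \<Rightarrow> real^'n^'m \<Rightarrow> real^'n^'n" where
  "X_sol A B Bw Q R \<beta> K =
     (THE X. pos_semidef X \<and>
        closed_loop A B K ** X + X ** transpose (closed_loop A B K)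
          + (inverse (\<beta>^2)) *\<^sub>R (X ** S_mat Q R K ** X) + Bw ** transpose Bw = 0 \<and>
        hurwitz (closed_loop A B K + (inverse (\<beta>^2)) *\<^sub>R (X ** S_mat Q R K)))"

definition J_mix ::
  "real^'n^'n \<Rightarrow> real^'m^'n \<Rightarrow> real^'n^'n \<Rightarrow> real^'n^'n \<Rightarrow> real^'m^'m \<Rightarrow> real
     \<Rightarrow> real^'n^'m \<Rightarrow> real" where
  "J_mix A B Bw Q R \<beta> K = trace (S_mat Q R K ** X_sol A B Bw Q R \<beta> K)"

definition stationary ::
  "real^'n^'n \<Rightarrow> real^'m^'n \<Rightarrow> real^'n^'n \<Rightarrow> real^'n^'n \<Rightarrow> real^'m^'m \<Rightarrow> real
     \<Rightarrow> real^'n^'m \<Rightarrow> bool" where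
  "stationary A B Bw Q R \<beta> K \<longleftrightarrow>
     K \<in> K_beta A B Bw Q R \<beta> \<and> (J_mix A B Bw Q R \<beta> has_derivative (\<lambda>_. 0)) (at K)"

definition stab_ARE_sol ::
  "real^'n^'n \<Rightarrow> real^'m^'n \<Rightarrow> real^'n^'n \<Rightarrow> real^'n^'n \<Rightarrow> real^'m^'m \<Rightarrow> real
     \<Rightarrow> real^'n^'n \<Rightarrow> bool" where
  "stab_ARE_sol A B Bw Q R \<beta> P \<longleftrightarrow>
     (let M = (inverse (\<beta>^2)) *\<^sub>R (Bw ** transpose Bw) - B ** matrix_inv R ** transpose B
      in sym_mat P \<and> transpose A ** P + P ** A + P ** M ** P + Q = 0 \<and> hurwitz (A + M ** P))"

end

theory Submission
  imports Defs "HOL-Computational_Algebra.Fundamental_Theorem_Algebra"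
begin

text \<open>With \<open>U = \<beta>\<^sup>-\<^sup>2 X\<close>, \<open>V = \<beta>\<^sup>-\<^sup>2 W\<close> and \<open>A\<^sub>U = A\<^sub>K + U S\<^sub>K\<close>, the Riccati equation of a gain reads
  \<open>A\<^sub>K U + U A\<^sub>K\<^sup>T + U S\<^sub>K U + V = 0\<close>. If \<open>Y\<close> solves \<open>A\<^sub>U\<^sup>T Y + Y A\<^sub>U + S\<^sub>K = 0\<close>, the derivative of
  the cost in direction \<open>E\<close> is \<open>2 \<beta>\<^sup>2 tr (U Y P\<^sup>-\<^sup>1 (K\<^sup>T R + P B) E)\<close> where \<open>P\<^sup>-\<^sup>1 = Y\<^sup>-\<^sup>1 + U\<close>, so a stationary gain is
  \<open>K = - R\<^sup>-\<^sup>1 B\<^sup>T P\<close>. Adding the equations of \<open>U\<close> and \<open>Y\<^sup>-\<^sup>1\<close> shows that \<open>P\<close> is the stabilizing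
  solution of \<open>A\<^sub>K\<^sup>T P + P A\<^sub>K + P V P + S\<^sub>K = 0\<close>; for this gain the equation is the stated
  algebraic Riccati equation, and stabilizing solutions are unique by injectivity of Sylvester operators.

  Existence rests on one fact: for \<open>S > 0\<close>, a strict solution of the Riccati inequality yields a stabilizing
  solution of the equation. The norm bound is turned into a strict solution by a homotopy in \<open>V\<close>, and
  completing the square makes a strict solution for some gain one for the equation of \<open>P\<^sup>-\<^sup>1\<close>,
  whose quadratic term \<open>Q\<close> is again definite.\<close>

text \<open>The quadratic term \<beta>^-2 W - B R^-1 B^T of the stated equation is indefinite, so an
  existence result for a definite quadratic term cannot be applied to it directly. Inversion
  exchanges quadratic and constant term, but it also reverses stability: P is stabilizing when its
  inverse is antistabilizing. Hence solutions of both kinds are needed; U and U + Y^-1 are the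
  stabilizing and the antistabilizing solution of one and the same equation. Strict inequalities
  link the steps, since they survive small perturbations and the addition of squares, while the
  limits of stabilizing solutions may a priori acquire imaginary eigenvalues. Differentiability of
  the cost comes from comparison: nearby solutions are squeezed between U - eD and U + eD, this is
  sharpened to a Lipschitz estimate, and pairing with Y removes the derivative of the solution from
  the first-order expansion. Lyapunov equations are solved by finite-dimensional injectivity, so no
  matrix exponential occurs.\<close>

section \<open>Matrix algebra\<close>

lemma matrix_minus_left: "(- A) ** B = - (A ** B)" for A :: "'a::ring_1^'n^'m"
  by (simp add: vec_eq_iff matrix_matrix_mult_def sum_negf)

lemma matrix_minus_right: "A ** (- B) = - (A ** B)" for A :: "'a::ring_1^'n^'m"
  by (simp add: vec_eq_iff matrix_matrix_mult_def sum_negf)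

lemma matrix_diff_left: "(A - B) ** C = A ** C - B ** C" for A :: "'a::ring_1^'n^'m"
  by (simp add: vec_eq_iff matrix_matrix_mult_def sum_subtractf algebra_simps)

lemma matrix_diff_right: "A ** (B - C) = A ** B - A ** C" for A :: "'a::ring_1^'n^'m"
  by (simp add: vec_eq_iff matrix_matrix_mult_def sum_subtractf algebra_simps)

lemma matrix_add_left: "(A + B) ** C = A ** C + B ** C" for A :: "'a::semiring_1^'n^'m"
  by (simp add: vec_eq_iff matrix_matrix_mult_def sum.distrib algebra_simps)

lemma matrix_scaleR_left: "(c *\<^sub>R A) ** B = c *\<^sub>R (A ** B)" for A :: "real^'n^'m"
  by (simp add: vec_eq_iff matrix_matrix_mult_def sum_distrib_left mult.assoc)

lemma matrix_scaleR_right: "A ** (c *\<^sub>R B) = c *\<^sub>R (A ** B)" for A :: "real^'n^'m"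
  by (simp add: vec_eq_iff matrix_matrix_mult_def sum_distrib_left ac_simps)

lemma transpose_add: "transpose (A + B) = transpose A + transpose B"
  by (simp add: vec_eq_iff transpose_def)

lemma transpose_diff: "transpose (A - B) = transpose A - transpose B"
  by (simp add: vec_eq_iff transpose_def)

lemma transpose_minus: "transpose (- A) = - transpose A"
  by (simp add: vec_eq_iff transpose_def)

lemma transpose_zero [simp]: "transpose 0 = 0"
  by (simp add: vec_eq_iff transpose_def)

lemmas matrix_ring =
  matrix_add_ldistrib matrix_add_left matrix_minus_left matrix_minus_right
  matrix_diff_left matrix_diff_right matrix_scaleR_left matrix_scaleR_right
  matrix_mul_assoc transpose_add transpose_diff transpose_minus transpose_scalar
  matrix_transpose_mul

lemma matrix_vector_minus_left: "(- A) *v x = - (A *v x)" for A :: "'a::ring_1^'n^'m"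
  by (simp add: vec_eq_iff matrix_vector_mult_def sum_negf)

lemma matrix_vector_minus_right: "A *v (- x) = - (A *v x)" for A :: "'a::ring_1^'n^'m"
  by (simp add: vec_eq_iff matrix_vector_mult_def sum_negf)

lemma matrix_vector_scaleR_left: "(c *\<^sub>R A) *v x = c *\<^sub>R (A *v x)" for A :: "real^'n^'m"
  by (simp add: scaleR_matrix_vector_assoc)

lemmas mat_vec =
  matrix_vector_right_distrib matrix_vector_mult_diff_distrib matrix_vector_mult_add_rdistrib
  matrix_vector_mult_diff_rdistrib matrix_vector_minus_left matrix_vector_minus_right
  matrix_vector_scaleR_left matrix_vector_mult_scaleR matrix_vector_mul_assoc[symmetric]

lemma inner_matrix_vector: "x \<bullet> (A *v y) = (transpose A *v x) \<bullet> y" for A :: "real^'n^'m"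
  by (simp add: dot_lmul_matrix)

lemma inner_matrix_vector_left: "(A *v x) \<bullet> y = x \<bullet> (transpose A *v y)" for A :: "real^'n^'m"
  using inner_matrix_vector[of x "transpose A" y] by (simp only: transpose_transpose)

lemma invertible_inv:
  fixes A :: "'a::field^'n^'n"
  assumes "det A \<noteq> 0"
  shows "matrix_inv A ** A = mat 1" "A ** matrix_inv A = mat 1"
  using assms invertible_det_nz[of A] unfolding invertible_def matrix_inv_def
  by (metis (mono_tags, lifting) someI_ex)+

lemma det_eq_0_iff: "det A = 0 \<longleftrightarrow> (\<exists>v. v \<noteq> 0 \<and> A *v v = 0)" for A :: "'a::field^'n^'n"
proof -
  have "det A \<noteq> 0 \<longleftrightarrow> (\<forall>v. A *v v = 0 \<longrightarrow> v = 0)"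
    using invertible_det_nz[of A] invertible_left_inverse[of A] matrix_left_invertible_ker[of A] by auto
  then show ?thesis by blast
qed

section \<open>Real form of the Hurwitz condition\<close>

definition cvec :: "real^'n \<Rightarrow> real^'n \<Rightarrow> complex^'n" where
  "cvec a b = (\<chi> i. Complex (a $ i) (b $ i))"

lemma cvec_cases: obtains a b where "y = cvec a b"
proof
  show "y = cvec (\<chi> i. Re (y $ i)) (\<chi> i. Im (y $ i))"
    by (simp add: cvec_def vec_eq_iff)
qed

lemma cvec_eq_iff [simp]: "cvec a b = cvec c d \<longleftrightarrow> a = c \<and> b = d"
  by (auto simp: cvec_def vec_eq_iff)

lemma cvec_eq_0_iff [simp]: "cvec a b = 0 \<longleftrightarrow> a = 0 \<and> b = 0"
  by (auto simp: cvec_def vec_eq_iff complex_eq_iff)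

lemma cmat_cvec: "cmat M *v cvec a b = cvec (M *v a) (M *v b)"
  by (simp add: cmat_def cvec_def vec_eq_iff matrix_vector_mult_def complex_eq_iff)

lemma mat_cvec: "mat z *v cvec a b = cvec (Re z *\<^sub>R a - Im z *\<^sub>R b) (Re z *\<^sub>R b + Im z *\<^sub>R a)"
proof -
  have "mat z *v y = (\<chi> i. z * y $ i)" for y :: "complex^'n"
    by (simp add: mat_def vec_eq_iff matrix_vector_mult_def if_distrib[of "\<lambda>x. x * _"] cong: if_cong)
  from this[of "cvec a b"] show ?thesis
    by (simp add: cvec_def vec_eq_iff complex_eq_iff)
qed

lemma norm_cvec: "(norm (cvec a b))\<^sup>2 = (norm a)\<^sup>2 + (norm b)\<^sup>2"
  by (simp add: cvec_def norm_vec_def L2_set_def sum_nonneg cmod_def sum.distrib)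

lemma cvec_diff: "cvec a b - cvec c d = cvec (a - c) (b - d)"
  by (simp add: cvec_def vec_eq_iff complex_eq_iff)

text \<open>Splitting an eigenvector as a + ib turns complex spectra into pairs of real equations,
  so symmetric forms can be evaluated on \<open>a\<close> and \<open>b\<close> separately.\<close>

lemma det_mat_minus_cmat_eq_0_iff:
  "det (mat z - cmat M) = 0 \<longleftrightarrow>
     (\<exists>a b. \<not> (a = 0 \<and> b = 0) \<and> M *v a = Re z *\<^sub>R a - Im z *\<^sub>R b \<and> M *v b = Re z *\<^sub>R b + Im z *\<^sub>R a)"
proof -
  have "det (mat z - cmat M) = 0 \<longleftrightarrow>
        (\<exists>a b. cvec a b \<noteq> 0 \<and> (mat z - cmat M) *v cvec a b = 0)"
    unfolding det_eq_0_iff by (metis cvec_cases)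
  also have "\<dots> \<longleftrightarrow> (\<exists>a b. cvec a b \<noteq> 0 \<and> mat z *v cvec a b = cmat M *v cvec a b)"
    by (simp add: matrix_vector_mult_diff_rdistrib)
  finally show ?thesis
    unfolding mat_cvec cmat_cvec cvec_eq_iff cvec_eq_0_iff by metis
qed

lemma hurwitz_iff:
  "hurwitz M \<longleftrightarrow> (\<forall>a b \<alpha> \<omega>. M *v a = \<alpha> *\<^sub>R a - \<omega> *\<^sub>R b \<and> M *v b = \<alpha> *\<^sub>R b + \<omega> *\<^sub>R a \<and> \<alpha> \<ge> 0
      \<longrightarrow> a = 0 \<and> b = 0)"
proof
  assume h: "hurwitz M"
  show "\<forall>a b \<alpha> \<omega>. M *v a = \<alpha> *\<^sub>R a - \<omega> *\<^sub>R b \<and> M *v b = \<alpha> *\<^sub>R b + \<omega> *\<^sub>R a \<and> \<alpha> \<ge> 0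
    \<longrightarrow> a = 0 \<and> b = 0"
    using h det_mat_minus_cmat_eq_0_iff[of "Complex _ _"] unfolding hurwitz_def
    by (metis complex.sel not_less)
next
  assume "\<forall>a b \<alpha> \<omega>. M *v a = \<alpha> *\<^sub>R a - \<omega> *\<^sub>R b \<and> M *v b = \<alpha> *\<^sub>R b + \<omega> *\<^sub>R a \<and> \<alpha> \<ge> 0
    \<longrightarrow> a = 0 \<and> b = 0"
  then show "hurwitz M"
    unfolding hurwitz_def det_mat_minus_cmat_eq_0_iff by (metis not_less)
qed

lemma hurwitz_transpose: "hurwitz (transpose M) \<longleftrightarrow> hurwitz M"
proof -
  have "mat z - cmat (transpose M) = transpose (mat z - cmat M)" for z
    by (auto simp: cmat_def transpose_def mat_def vec_eq_iff)
  then show ?thesis by (simp add: hurwitz_def)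
qed

text \<open>\<open>N\<close> carries eigenvectors of \<open>M\<close> to eigenvectors of
  \<open>M'\<close> for the same eigenvalue; injectivity keeps them nonzero.\<close>

lemma hurwitz_similar:
  assumes "hurwitz M'" "N ** M = M' ** N" "\<And>x. N *v x = 0 \<Longrightarrow> x = 0"
  shows "hurwitz M"
  unfolding hurwitz_iff
proof clarify
  fix a b \<alpha> \<omega>
  assume a: "M *v a = \<alpha> *\<^sub>R a - \<omega> *\<^sub>R b" and b: "M *v b = \<alpha> *\<^sub>R b + \<omega> *\<^sub>R a" and "\<alpha> \<ge> (0::real)"
  have "M' *v (N *v x) = N *v (M *v x)" for x
    by (metis assms(2) matrix_vector_mul_assoc)
  then have "M' *v (N *v a) = \<alpha> *\<^sub>R (N *v a) - \<omega> *\<^sub>R (N *v b)" "M' *v (N *v b) = \<alpha> *\<^sub>R (N *v b) + \<omega> *\<^sub>R (N *v a)"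
    by (simp_all add: a b mat_vec)
  then show "a = 0 \<and> b = 0"
    using assms(1,3) \<open>\<alpha> \<ge> 0\<close> unfolding hurwitz_iff by blast
qed

section \<open>Definite matrices\<close>

lemma sym_matD: "sym_mat M \<Longrightarrow> transpose M = M"
  by (simp add: sym_mat_def)

lemma pos_def_sym: "pos_def M \<Longrightarrow> sym_mat M"
  and pos_semidef_sym: "pos_semidef M \<Longrightarrow> sym_mat M"
  by (simp_all add: pos_def_def pos_semidef_def)

lemma pos_def_pos: "pos_def M \<Longrightarrow> x \<noteq> 0 \<Longrightarrow> x \<bullet> (M *v x) > 0"
  by (simp add: pos_def_def)

lemma pos_semidef_nonneg: "pos_semidef M \<Longrightarrow> x \<bullet> (M *v x) \<ge> 0"
  by (simp add: pos_semidef_def)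

lemma pos_def_imp_pos_semidef: "pos_def M \<Longrightarrow> pos_semidef M"
  unfolding pos_def_def pos_semidef_def
  by (metis inner_zero_left less_eq_real_def)

lemma sym_mat_simps [simp]:
  "sym_mat M \<Longrightarrow> sym_mat N \<Longrightarrow> sym_mat (M + N)"
  "sym_mat M \<Longrightarrow> sym_mat N \<Longrightarrow> sym_mat (M - N)"
  "sym_mat M \<Longrightarrow> sym_mat (- M)"
  "sym_mat M \<Longrightarrow> sym_mat (c *\<^sub>R M)"
  "sym_mat 0" "sym_mat (mat k)"
  by (simp_all add: sym_mat_def transpose_add transpose_diff transpose_minus transpose_scalar)

lemma pos_def_mat_1: "pos_def (mat 1)"
  by (simp add: pos_def_def)

lemma pos_def_add_pos_semidef: "pos_def M \<Longrightarrow> pos_semidef N \<Longrightarrow> pos_def (M + N)"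
  by (auto simp: pos_def_def pos_semidef_def mat_vec inner_add_right add_pos_nonneg)

lemma pos_semidef_add: "pos_semidef M \<Longrightarrow> pos_semidef N \<Longrightarrow> pos_semidef (M + N)"
  by (auto simp: pos_semidef_def mat_vec inner_add_right)

lemma pos_def_scaleR: "pos_def M \<Longrightarrow> c > 0 \<Longrightarrow> pos_def (c *\<^sub>R M)"
  by (auto simp: pos_def_def mat_vec)

lemma pos_semidef_scaleR: "pos_semidef M \<Longrightarrow> c \<ge> 0 \<Longrightarrow> pos_semidef (c *\<^sub>R M)"
  by (auto simp: pos_semidef_def mat_vec)

lemma pos_semidef_congruence:
  fixes C :: "real^'n^'m"
  assumes "pos_semidef M"
  shows "pos_semidef (transpose C ** M ** C)"
proof -
  have "x \<bullet> ((transpose C ** M ** C) *v x) = (C *v x) \<bullet> (M *v (C *v x))" for x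
    by (simp only: matrix_vector_mul_assoc[symmetric] inner_matrix_vector transpose_transpose)
  then show ?thesis
    using assms by (simp add: pos_semidef_def sym_mat_def matrix_transpose_mul matrix_mul_assoc)
qed

lemma pos_semidef_sandwich:
  assumes "pos_semidef M" "sym_mat C"
  shows "pos_semidef (C ** M ** C)"
  using pos_semidef_congruence[OF assms(1), of C] assms(2) by (simp add: sym_matD)

text \<open>Moving from \<open>x\<close> against \<open>M *v x\<close> changes the form by a
  quadratic in the step length with negative linear term, so it would drop below zero.\<close>

lemma pos_semidef_null:
  assumes "pos_semidef M" "x \<bullet> (M *v x) = 0"
  shows "M *v x = 0"
proof (rule ccontr)
  assume ne: "M *v x \<noteq> 0"
  define y where "y = M *v x"
  have t: "transpose M = M" using assms(1) by (simp add: pos_semidef_def sym_mat_def)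
  have sw: "x \<bullet> (M *v y) = y \<bullet> y"
    by (simp only: inner_matrix_vector t y_def)
  have *: "0 \<le> - 2 * s * (y \<bullet> y) + s\<^sup>2 * (y \<bullet> (M *v y))" for s
  proof -
    have "0 \<le> (x - s *\<^sub>R y) \<bullet> (M *v (x - s *\<^sub>R y))"
      using assms(1) by (simp add: pos_semidef_def)
    also have "\<dots> = - 2 * s * (y \<bullet> y) + s\<^sup>2 * (y \<bullet> (M *v y))"
      by (simp add: mat_vec inner_diff_left inner_diff_right assms(2)[folded y_def] sw y_def[symmetric] power2_eq_square algebra_simps)
    finally show ?thesis .
  qed
  define k where "k = y \<bullet> (M *v y)"
  have yy: "y \<bullet> y > 0" using ne by (simp add: y_def)
  have k: "k \<ge> 0" using assms(1) by (simp add: pos_semidef_def k_def)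
  \<comment> \<open>Close to the minimiser of the quadratic; \<open>k + 1\<close> in place of
    \<open>k\<close> covers a vanishing \<open>k\<close>.\<close>
  define w where "w = (y \<bullet> y) / (k + 1)"
  have w: "y \<bullet> y = w * (k + 1)" "w > 0"
    using k yy by (simp_all add: w_def)
  have "0 \<le> - 2 * w * (y \<bullet> y) + w\<^sup>2 * k"
    using *[of w] by (simp add: k_def)
  also have "\<dots> = w\<^sup>2 * (k - 2 * (k + 1))"
    unfolding w(1) by (simp add: power2_eq_square algebra_simps)
  also have "\<dots> < 0"
    using k w(2) by (intro mult_pos_neg) auto
  finally show False by simp
qed

lemma pos_def_iff_pos_semidef: "pos_def M \<longleftrightarrow> pos_semidef M \<and> (\<forall>x. M *v x = 0 \<longrightarrow> x = 0)"
proof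
  assume M: "pos_def M"
  have "x = 0" if "M *v x = 0" for x
    using pos_def_pos[OF M, of x] that by force
  then show "pos_semidef M \<and> (\<forall>x. M *v x = 0 \<longrightarrow> x = 0)"
    using pos_def_imp_pos_semidef[OF M] by blast
next
  assume M: "pos_semidef M \<and> (\<forall>x. M *v x = 0 \<longrightarrow> x = 0)"
  have "x \<bullet> (M *v x) > 0" if "x \<noteq> 0" for x
  proof -
    have "x \<bullet> (M *v x) \<noteq> 0"
      using M pos_semidef_null[of M x] that by blast
    moreover have "x \<bullet> (M *v x) \<ge> 0"
      using M pos_semidef_nonneg by blast
    ultimately show ?thesis by simp
  qed
  then show "pos_def M"
    using M by (simp add: pos_def_def pos_semidef_def)
qed

lemma norm_matrix_vector: "norm (A *v x) \<le> norm A * norm x" for A :: "real^'n^'m"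
proof -
  have "norm (A *v x) \<le> L2_set (\<lambda>i. norm (A $ i) * norm x) UNIV"
    unfolding norm_vec_def[of "A *v x"]
    by (rule L2_set_mono) (auto simp: matrix_vector_mul_component Cauchy_Schwarz_ineq2)
  also have "\<dots> = norm A * norm x"
    by (simp add: norm_vec_def[of A] L2_set_left_distrib)
  finally show ?thesis .
qed

lemma pos_def_lower_bound:
  fixes M :: "real^'n^'n"
  assumes "pos_def M"
  obtains c where "c > 0" "\<And>x. c * (norm x)\<^sup>2 \<le> x \<bullet> (M *v x)"
proof -
  have c: "compact (sphere (0::real^'n) 1)" by simp
  have n: "sphere (0::real^'n) 1 \<noteq> {}" by simp
  have "continuous_on (sphere 0 1) (\<lambda>x. x \<bullet> (M *v x))"
    by (intro continuous_intros linear_continuous_on matrix_vector_mul_bounded_linear)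
  from continuous_attains_inf[OF c n this]
  obtain u where u: "u \<in> sphere 0 1" "\<And>x. x \<in> sphere 0 1 \<Longrightarrow> u \<bullet> (M *v u) \<le> x \<bullet> (M *v x)"
    by blast
  show ?thesis
  proof
    show "u \<bullet> (M *v u) > 0"
      using u(1) assms by (intro pos_def_pos) auto
    show "u \<bullet> (M *v u) * (norm x)\<^sup>2 \<le> x \<bullet> (M *v x)" for x
    proof (cases "x = 0")
      case False
      have "u \<bullet> (M *v u) \<le> (x /\<^sub>R norm x) \<bullet> (M *v (x /\<^sub>R norm x))"
        using False by (intro u(2)) auto
      also have "\<dots> = x \<bullet> (M *v x) / (norm x)\<^sup>2"
        by (simp add: mat_vec power2_eq_square divide_inverse mult.commute)
      finally show ?thesis using False by (simp add: field_simps)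
    qed auto
  qed
qed

text \<open>A form bounded below by c |x|^2 tolerates every perturbation of norm less than c.
  Symmetry is a separate premise because definiteness is open only among symmetric matrices.\<close>

lemma pos_def_eventually:
  fixes f :: "'a \<Rightarrow> real^'n^'n"
  assumes "pos_def M" "(f \<longlongrightarrow> M) F" "\<forall>\<^sub>F t in F. sym_mat (f t)"
  shows "\<forall>\<^sub>F t in F. pos_def (f t)"
proof -
  obtain c where c: "c > 0" "\<And>x. c * (norm x)\<^sup>2 \<le> x \<bullet> (M *v x)"
    using pos_def_lower_bound[OF assms(1)] by blast
  have "\<forall>\<^sub>F t in F. dist (f t) M < c"
    using assms(2) c(1) by (rule tendstoD)
  then show ?thesis
    using assms(3)
  proof eventually_elim
    case (elim t)
    have "x \<bullet> (f t *v x) > 0" if "x \<noteq> 0" for x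
    proof -
      have "\<bar>x \<bullet> ((f t - M) *v x)\<bar> \<le> norm x * (norm (f t - M) * norm x)"
        by (meson Cauchy_Schwarz_ineq2 order_trans mult_left_mono norm_ge_zero norm_matrix_vector)
      also have "\<dots> < c * (norm x)\<^sup>2"
        using elim(1) that by (simp add: dist_norm power2_eq_square)
      also have "\<dots> \<le> x \<bullet> (M *v x)" by (rule c)
      finally show ?thesis by (simp add: mat_vec inner_diff_right)
    qed
    with elim show ?case by (simp add: pos_def_def)
  qed
qed

section \<open>Lyapunov equations\<close>

definition lyap :: "real^'n^'n \<Rightarrow> real^'n^'n \<Rightarrow> real^'n^'n" where
  "lyap A X = A ** X + X ** transpose A"

lemma sym_lyap [simp]: "sym_mat X \<Longrightarrow> sym_mat (lyap A X)"
  by (simp add: lyap_def sym_mat_def matrix_ring add.commute)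

lemma lyap_add: "lyap A (X + Y) = lyap A X + lyap A Y"
  and lyap_diff: "lyap A (X - Y) = lyap A X - lyap A Y"
  and lyap_scaleR: "lyap A (c *\<^sub>R X) = c *\<^sub>R lyap A X"
  by (simp_all add: lyap_def matrix_ring algebra_simps)

text \<open>In particular the form of \<open>lyap A X\<close> vanishes on the kernel of
  \<open>X\<close>, which is how null vectors are excluded below.\<close>

lemma lyap_quadratic_form:
  assumes "sym_mat X"
  shows "x \<bullet> (lyap A X *v x) = 2 * ((transpose A *v x) \<bullet> (X *v x))"
proof -
  have "x \<bullet> (A *v (X *v x)) = (transpose A *v x) \<bullet> (X *v x)"
    by (rule inner_matrix_vector)
  moreover have "x \<bullet> (X *v (transpose A *v x)) = (transpose A *v x) \<bullet> (X *v x)"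
    using assms by (simp only: inner_matrix_vector[of x X] sym_matD inner_commute)
  ultimately show ?thesis
    by (simp only: lyap_def mat_vec inner_add_right)
qed

text \<open>On the real and imaginary parts of an eigenvector of the transpose, the forms of
  \<open>lyap A D\<close> add up to twice the real part of the eigenvalue times a nonnegative
  number. Semidefinite \<open>D\<close> suffices, and differences of Riccati solutions provide such
  \<open>D\<close>.\<close>

lemma lyap_imp_hurwitz:
  assumes "pos_semidef D" "pos_def (- lyap A D)"
  shows "hurwitz A"
proof -
  have "hurwitz (transpose A)"
    unfolding hurwitz_iff
  proof clarify
    fix a b \<alpha> \<omega>
    assume a: "transpose A *v a = \<alpha> *\<^sub>R a - \<omega> *\<^sub>R b" and b: "transpose A *v b = \<alpha> *\<^sub>R b + \<omega> *\<^sub>R a" and "\<alpha> \<ge> (0::real)"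
    have D: "sym_mat D" using assms(1) by (rule pos_semidef_sym)
    have "b \<bullet> (D *v a) = a \<bullet> (D *v b)"
      using D by (simp only: inner_matrix_vector[of b D] sym_matD inner_commute)
    then have "a \<bullet> (lyap A D *v a) + b \<bullet> (lyap A D *v b) = 2 * \<alpha> * (a \<bullet> (D *v a) + b \<bullet> (D *v b))"
      unfolding lyap_quadratic_form[OF D] a b by (simp add: inner_simps algebra_simps)
    also have "\<dots> \<ge> 0"
      using \<open>\<alpha> \<ge> 0\<close> pos_semidef_nonneg[OF assms(1)] by (simp add: add_nonneg_nonneg)
    finally have *: "a \<bullet> ((- lyap A D) *v a) + b \<bullet> ((- lyap A D) *v b) \<le> 0"
      by (simp add: matrix_vector_minus_left)
    have "a \<bullet> ((- lyap A D) *v a) \<ge> 0" "b \<bullet> ((- lyap A D) *v b) \<ge> 0"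
      using assms(2) pos_def_imp_pos_semidef pos_semidef_nonneg by blast+
    then show "a = 0 \<and> b = 0"
      using * pos_def_pos[OF assms(2), of a] pos_def_pos[OF assms(2), of b] by linarith
  qed
  then show ?thesis by (simp add: hurwitz_transpose)
qed

text \<open>The smallest \<^term>\<open>t\<close> making \<^term>\<open>X + t *\<^sub>R Y\<close> semidefinite leaves a null vector; the
  Lyapunov operator at that matrix would have to be negative on it.\<close>

lemma lyap_inverse_positive:
  fixes X Y :: "real^'n^'n"
  assumes "pos_def Y" "pos_def (- lyap A Y)" "sym_mat X" "pos_semidef (- lyap A X)"
  shows "pos_semidef X"
proof (rule ccontr)
  assume neg: "\<not> pos_semidef X"
  have c: "compact (sphere (0::real^'n) 1)" by simp
  have n: "sphere (0::real^'n) 1 \<noteq> {}" by simp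
  have Yp: "x \<bullet> (Y *v x) > 0" if "x \<noteq> 0" for x
    using assms(1) that by (rule pos_def_pos)
  have "x \<bullet> (Y *v x) \<noteq> 0" if "x \<in> sphere 0 1" for x
    using Yp[of x] that by (cases "x = 0") auto
  then have "continuous_on (sphere 0 1) (\<lambda>x. x \<bullet> (X *v x) / (x \<bullet> (Y *v x)))"
    by (intro continuous_intros linear_continuous_on matrix_vector_mul_bounded_linear) blast
  from continuous_attains_inf[OF c n this]
  obtain u where u: "u \<in> sphere 0 1" and
     umin: "\<And>x. x \<in> sphere 0 1 \<Longrightarrow> u \<bullet> (X *v u) / (u \<bullet> (Y *v u)) \<le> x \<bullet> (X *v x) / (x \<bullet> (Y *v x))"
    by blast
  \<comment> \<open>The least Rayleigh quotient of \<open>X\<close> relative to \<open>Y\<close>: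
    \<open>- r\<close> is the critical multiple of \<open>Y\<close>, and the minimiser
    \<open>u\<close> is the null vector.\<close>
  define r where "r = u \<bullet> (X *v u) / (u \<bullet> (Y *v u))"
  have u0: "u \<noteq> 0" using u by auto
  have le: "r * (x \<bullet> (Y *v x)) \<le> x \<bullet> (X *v x)" for x
  proof (cases "x = 0")
    case False
    have "r \<le> (x /\<^sub>R norm x) \<bullet> (X *v (x /\<^sub>R norm x)) / ((x /\<^sub>R norm x) \<bullet> (Y *v (x /\<^sub>R norm x)))"
      unfolding r_def using False by (intro umin) auto
    also have "\<dots> = x \<bullet> (X *v x) / (x \<bullet> (Y *v x))"
      using False by (simp add: mat_vec divide_simps)
    finally show ?thesis using Yp[OF False] by (simp add: field_simps)
  qed auto
  have r: "r < 0"
  proof (rule ccontr)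
    assume "\<not> r < 0"
    then have "r * (x \<bullet> (Y *v x)) \<ge> 0" for x
      using Yp[of x] by (cases "x = 0") auto
    then have "x \<bullet> (X *v x) \<ge> 0" for x
      using le order_trans by blast
    then show False using neg assms(3) by (simp add: pos_semidef_def)
  qed
  define Z where "Z = X - r *\<^sub>R Y"
  have Z: "pos_semidef Z"
    using le assms(1,3) by (auto simp: pos_semidef_def Z_def mat_vec inner_diff_right pos_def_sym)
  have "u \<bullet> (Z *v u) = 0"
    using Yp[OF u0] by (simp add: Z_def mat_vec inner_diff_right r_def)
  then have "Z *v u = 0" using Z pos_semidef_null by blast
  then have "u \<bullet> (lyap A Z *v u) = 0"
    by (simp add: lyap_quadratic_form pos_semidef_sym[OF Z])
  moreover have "u \<bullet> (lyap A Z *v u) = u \<bullet> (lyap A X *v u) - r * (u \<bullet> (lyap A Y *v u))"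
    by (simp add: Z_def lyap_diff lyap_scaleR mat_vec inner_diff_right)
  moreover have "u \<bullet> (lyap A X *v u) \<le> 0"
    using pos_semidef_nonneg[OF assms(4), of u] by (simp add: matrix_vector_minus_left)
  moreover have "r * (u \<bullet> (lyap A Y *v u)) > 0"
    using pos_def_pos[OF assms(2) u0] r by (simp add: matrix_vector_minus_left mult_neg_neg)
  ultimately show False by simp
qed

section \<open>Invariant subspaces of matrices and the Sylvester equation\<close>

text \<open>This is p(M) Z by Horner's rule. It acts on rectangular \<open>Z\<close> because the
  invariant spaces of interest consist of matrices.\<close>

definition mop :: "complex^'n^'n \<Rightarrow> complex poly \<Rightarrow> complex^'k^'n \<Rightarrow> complex^'k^'n" where
  "mop M p Z = fold_coeffs (\<lambda>c W. mat c ** Z + M ** W) p 0"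

lemma mop_0 [simp]: "mop M 0 Z = 0"
  by (simp add: mop_def)

lemma mop_pCons [simp]: "mop M (pCons c p) Z = mat c ** Z + M ** mop M p Z"
  by (cases "p = 0 \<and> c = 0") (auto simp: mop_def)

lemma mat_mul_mat: "mat a ** mat b = (mat (a * b) :: 'a::semiring_1^'n^'n)"
proof -
  have "(\<Sum>k\<in>UNIV. (if i = k then a else 0) * (if k = j then b else 0)) = (if i = j then a * b else 0)" for i j :: 'n
    by (simp add: if_distrib[of "\<lambda>x. x * _"] cong: if_cong)
  then show ?thesis
    by (simp add: mat_def matrix_matrix_mult_def vec_eq_iff)
qed

lemma mat_commute: "mat c ** Z = Z ** mat c" for Z :: "'a::comm_semiring_1^'k^'n"
  by (simp add: vec_eq_iff matrix_matrix_mult_def mat_def if_distrib[of "\<lambda>x. x * _"] if_distrib[of "\<lambda>x. _ * x"]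
      mult.commute cong: if_cong)

lemma mat_commute_mul: "M ** (mat c ** Z) = mat c ** (M ** Z)" for M :: "'a::comm_semiring_1^'k^'n"
  by (metis mat_commute matrix_mul_assoc)

lemma mat_add: "mat (a + b) = mat a + (mat b :: 'a::semiring_1^'n^'n)"
  by (simp add: mat_def vec_eq_iff)

lemma mat_minus: "mat (- a) = - (mat a :: 'a::ring_1^'n^'n)"
  by (simp add: mat_def vec_eq_iff)

lemma mat_scaleR: "mat (of_real c) ** Z = c *\<^sub>R Z" for Z :: "complex^'k^'n"
  by (simp add: vec_eq_iff matrix_matrix_mult_def mat_def if_distrib[of "\<lambda>x. x * _"] scaleR_conv_of_real[where 'a=complex] cong: if_cong)

lemma mop_add: "mop M (p + q) Z = mop M p Z + mop M q Z"
proof (induction p arbitrary: q)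
  case (pCons a p)
  show ?case
  proof (cases q)
    case (pCons b q')
    then show ?thesis
      using pCons.IH[of q'] by (simp add: mat_add matrix_add_ldistrib matrix_add_left algebra_simps)
  qed
qed simp

lemma mop_smult: "mop M (smult c p) Z = mat c ** mop M p Z"
  by (induction p) (simp_all add: mat_mul_mat[symmetric] matrix_mul_assoc[symmetric] matrix_add_ldistrib mat_commute_mul[of M])

lemma mop_minus: "mop M (- p) Z = - mop M p Z"
  using mop_smult[of M "-1" p Z] by (simp add: mat_minus matrix_minus_left)

lemma mop_diff: "mop M (p - q) Z = mop M p Z - mop M q Z"
  using mop_add[of M p "- q" Z] by (simp add: mop_minus)

lemma mop_sum: "mop M (\<Sum>i\<in>I. f i) Z = (\<Sum>i\<in>I. mop M (f i) Z)"
  by (induction I rule: infinite_finite_induct) (simp_all add: mop_add)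

text \<open>There are more powers M^i Z than the real dimension of the space. A repeated power is
  treated apart, since the set of powers is then too small for the counting argument but a
  difference of two monomials annihilates.\<close>

lemma mop_annihilator:
  fixes M :: "complex^'n^'n" and Z :: "complex^'k^'n"
  obtains p where "p \<noteq> 0" "mop M p Z = 0"
proof -
  define f where "f i = mop M (monom 1 i) Z" for i
  define d where "d = DIM(complex^'k^'n)"
  show ?thesis
  proof (cases "inj_on f {..d}")
    case True
    then have "card (f ` {..d}) = Suc d" by (simp add: card_image)
    then have "dependent (f ` {..d})" by (intro dependent_biggerset) (simp add: d_def)
    then obtain u where u: "\<exists>v\<in>f ` {..d}. u v \<noteq> 0" "(\<Sum>v\<in>f ` {..d}. u v *\<^sub>R v) = 0"
      using real_vector.dependent_finite[of "f ` {..d}"] by auto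
    define p where "p = (\<Sum>i\<le>d. smult (of_real (u (f i))) (monom 1 i :: complex poly))"
    obtain i where i: "i \<le> d" "u (f i) \<noteq> 0" using u(1) by auto
    have "coeff p i = (\<Sum>j\<le>d. if j = i then of_real (u (f j)) else 0)"
      by (simp add: p_def coeff_sum if_distrib[of "\<lambda>x. _ * x"] cong: if_cong)
    also have "\<dots> = of_real (u (f i))" using i by simp
    finally have p0: "p \<noteq> 0" using i(2) by auto
    have "mop M p Z = (\<Sum>i\<le>d. u (f i) *\<^sub>R f i)"
      by (simp add: p_def mop_sum mop_smult mat_scaleR f_def)
    also have "\<dots> = 0"
      using u(2) by (simp add: sum.reindex[OF True])
    finally show ?thesis using that p0 by blast
  next
    case False
    then obtain i j where ij: "i \<noteq> j" "f i = f j" by (auto simp: inj_on_def)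
    have "coeff (monom 1 i - monom (1::complex) j) i \<noteq> 0" using ij by simp
    then have "monom 1 i - monom (1::complex) j \<noteq> 0" by (metis coeff_0)
    moreover have "mop M (monom 1 i - monom 1 j) Z = 0"
      using ij by (simp add: mop_diff f_def)
    ultimately show ?thesis using that by blast
  qed
qed

text \<open>Split a root off an annihilator of least degree: the cofactor does not annihilate
  \<open>Z\<close>, and its value at \<open>Z\<close> is the eigenvector.\<close>

lemma invariant_subspace_eigen:
  fixes M :: "complex^'n^'n" and Z :: "complex^'k^'n"
  assumes Z: "Z \<in> U" "Z \<noteq> 0"
    and U: "\<And>X Y. X \<in> U \<Longrightarrow> Y \<in> U \<Longrightarrow> X + Y \<in> U" "\<And>c X. X \<in> U \<Longrightarrow> mat c ** X \<in> U" "\<And>X. X \<in> U \<Longrightarrow> M ** X \<in> U"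
  obtains Y \<mu> where "Y \<in> U" "Y \<noteq> 0" "M ** Y = mat \<mu> ** Y"
proof -
  have zero: "0 \<in> U" using U(2)[OF Z(1), of 0] by simp
  have mem: "mop M p Z \<in> U" for p
    by (induction p) (auto simp: zero intro!: U Z)
  define P where "P n \<longleftrightarrow> (\<exists>p. p \<noteq> 0 \<and> mop M p Z = 0 \<and> degree p = n)" for n
  have ex: "\<exists>n. P n" using mop_annihilator[of M Z] unfolding P_def by metis
  define n where "n = (LEAST n. P n)"
  obtain p where p: "p \<noteq> 0" "mop M p Z = 0" "degree p = n"
    using LeastI_ex[OF ex] unfolding n_def P_def by blast
  have "\<not> constant (poly p)"
  proof
    assume "constant (poly p)"
    then have "degree p = 0" by (simp add: constant_degree)
    then obtain c where c: "p = [:c:]" by (metis degree_eq_zeroE)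
    then have "mat c ** Z = 0" using p(2) by simp
    then have "mat (inverse c * c) ** Z = 0"
      by (simp add: mat_mul_mat[symmetric] matrix_mul_assoc[symmetric])
    then show False using p(1) Z(2) c by simp
  qed
  then obtain \<mu> where "poly p \<mu> = 0"
    using fundamental_theorem_of_algebra by blast
  then obtain q where q: "p = [:-\<mu>, 1:] * q"
    by (metis dvdE poly_eq_0_iff_dvd)
  then have q0: "q \<noteq> 0" using p(1) by auto
  have "degree p = degree [:-\<mu>, 1:] + degree q"
    unfolding q using q0 by (intro degree_mult_eq) auto
  then have "degree q < n" using p(3) by simp
  then have "mop M q Z \<noteq> 0"
    using q0 not_less_Least[of "degree q" P] unfolding n_def P_def by blast
  moreover have "p = pCons 0 q - smult \<mu> q" by (simp add: q)
  then have "M ** mop M q Z = mat \<mu> ** mop M q Z"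
    using p(2) by (simp add: mop_diff mop_smult)
  ultimately show ?thesis using that mem by blast
qed

section \<open>Injectivity of Sylvester operators\<close>

lemma cmat_mul: "cmat (A ** B) = cmat A ** cmat B"
  by (simp add: cmat_def matrix_matrix_mult_def vec_eq_iff)

lemma cmat_add: "cmat (A + B) = cmat A + cmat B"
  by (simp add: cmat_def vec_eq_iff)

lemma cmat_eq_0_iff: "cmat A = 0 \<longleftrightarrow> A = 0"
  by (simp add: cmat_def vec_eq_iff)

text \<open>The complex solutions are closed under left multiplication by A, so a nonzero one may be
  chosen with AY = \<mu>Y and hence YB = -\<mu>Y. Then \<mu> and -\<mu> are eigenvalues of A and B,
  and their real parts cannot both be negative.\<close>

lemma sylvester_injective:
  assumes "hurwitz A" "hurwitz B" "A ** X + X ** B = 0"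
  shows "X = 0"
proof (rule ccontr)
  assume "X \<noteq> 0"
  define U where "U = {Z. cmat A ** Z + Z ** cmat B = 0}"
  have X: "cmat X \<in> U"
    using arg_cong[OF assms(3), of cmat] by (simp add: U_def cmat_add cmat_mul cmat_eq_0_iff cmat_eq_0_iff[of 0, simplified])
  have U1: "Y + Z \<in> U" if "Y \<in> U" "Z \<in> U" for Y Z
  proof -
    have "cmat A ** (Y + Z) + (Y + Z) ** cmat B = (cmat A ** Y + Y ** cmat B) + (cmat A ** Z + Z ** cmat B)"
      by (simp add: matrix_add_ldistrib matrix_add_left)
    then show ?thesis using that by (simp add: U_def)
  qed
  have U2: "mat c ** Y \<in> U" if "Y \<in> U" for c Y
  proof -
    have "cmat A ** (mat c ** Y) + (mat c ** Y) ** cmat B = mat c ** (cmat A ** Y + Y ** cmat B)"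
      by (simp add: matrix_add_ldistrib mat_commute_mul matrix_mul_assoc[symmetric])
    then show ?thesis using that by (simp add: U_def)
  qed
  have U3: "cmat A ** Y \<in> U" if "Y \<in> U" for Y
  proof -
    have "cmat A ** (cmat A ** Y) + (cmat A ** Y) ** cmat B = cmat A ** (cmat A ** Y + Y ** cmat B)"
      by (simp add: matrix_add_ldistrib matrix_mul_assoc)
    then show ?thesis using that by (simp add: U_def)
  qed
  have "cmat X \<noteq> 0" using \<open>X \<noteq> 0\<close> by (simp add: cmat_eq_0_iff)
  from invariant_subspace_eigen[of "cmat X" U "cmat A", OF X this U1 U2 U3]
  obtain Y \<mu> where Y: "Y \<in> U" "Y \<noteq> 0" "cmat A ** Y = mat \<mu> ** Y" .
  have l: "(mat \<mu> - cmat A) ** Y = 0"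
    using Y(3) by (simp add: matrix_diff_left)
  have "Y ** mat \<mu> = mat \<mu> ** Y" by (rule mat_commute[symmetric])
  then have r: "Y ** (mat (-\<mu>) - cmat B) = 0"
    using Y(1,3) by (simp add: U_def matrix_diff_right mat_minus matrix_minus_right add_eq_0_iff)
  have "det (mat \<mu> - cmat A) = 0"
  proof (rule ccontr)
    assume "det (mat \<mu> - cmat A) \<noteq> 0"
    then have "Y = matrix_inv (mat \<mu> - cmat A) ** ((mat \<mu> - cmat A) ** Y)"
      by (simp add: matrix_mul_assoc invertible_inv)
    then show False using l Y(2) by simp
  qed
  moreover have "det (mat (-\<mu>) - cmat B) = 0"
  proof (rule ccontr)
    assume "det (mat (-\<mu>) - cmat B) \<noteq> 0"
    then have "Y = (Y ** (mat (-\<mu>) - cmat B)) ** matrix_inv (mat (-\<mu>) - cmat B)"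
      by (simp add: matrix_mul_assoc[symmetric] invertible_inv)
    then show False using r Y(2) by simp
  qed
  ultimately show False
    using assms(1,2) unfolding hurwitz_def by (metis less_asym neg_less_0_iff_less uminus_complex.sel(1))
qed

lemma lyap_injective:
  assumes "hurwitz A" "lyap A X = 0"
  shows "X = 0"
  using sylvester_injective[of A "transpose A" X] assms by (simp add: hurwitz_transpose lyap_def)

lemma linear_lyap: "linear (lyap A)"
  by (rule linearI) (simp_all add: lyap_add lyap_scaleR)

lemma transpose_lyap: "transpose (lyap A X) = lyap A (transpose X)"
  by (simp add: lyap_def matrix_ring add.commute)

text \<open>An injective operator on a finite-dimensional space is onto; symmetry follows since
  \<open>transpose X - X\<close> lies in the kernel.\<close>

lemma lyap_solve:
  assumes "hurwitz A" "sym_mat C"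
  obtains X where "sym_mat X" "lyap A X = C"
proof -
  have "inj (lyap A)"
    using linear_injective_0[OF linear_lyap] lyap_injective[OF assms(1)] by blast
  then have "surj (lyap A)"
    using linear_lyap linear_injective_imp_surjective by blast
  then obtain X where X: "lyap A X = C" by (metis surjD)
  have "lyap A (transpose X - X) = 0"
    using X assms(2) by (simp add: lyap_diff transpose_lyap[symmetric] sym_mat_def)
  then have "transpose X = X"
    using lyap_injective[OF assms(1)] by fastforce
  then show ?thesis using X that by (simp add: sym_mat_def)
qed

text \<open>Shift \<^term>\<open>A\<close> far enough to the left that the identity is a Lyapunov matrix and let the
  shift decrease: the infimum of admissible shifts is attained and cannot be positive.\<close>

lemma hurwitz_imp_lyap:
  fixes A :: "real^'n^'n"
  assumes "hurwitz A"
  obtains Y where "pos_def Y" "pos_def (- lyap A Y)"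
proof -
  define L where "L s \<longleftrightarrow> (\<exists>Y. pos_def Y \<and> pos_def (- lyap (A - mat s) Y))" for s
  have shift: "lyap (A - mat s) Y = lyap A Y - (2 * s) *\<^sub>R Y" for s and Y :: "real^'n^'n"
  proof -
    have m: "mat s ** Y = s *\<^sub>R Y" "Y ** mat s = s *\<^sub>R Y"
      by (simp_all add: vec_eq_iff matrix_matrix_mult_def mat_def if_distrib[of "\<lambda>x. x * _"]
          if_distrib[of "\<lambda>x. _ * x"] cong: if_cong)
    have "(2 * s) *\<^sub>R Y = s *\<^sub>R Y + s *\<^sub>R Y"
      by (metis mult_2 scaleR_left_distrib)
    then show ?thesis
      by (simp add: lyap_def matrix_diff_left matrix_diff_right transpose_diff m)
  qed
  have "\<exists>s\<ge>0. L s"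
  proof -
    define C where "C = lyap A (mat 1)"
    \<comment> \<open>A shift by \<open>s\<close> adds 2s to the form, and 2s exceeds
      \<open>norm C\<close>.\<close>
    define s where "s = norm C + 1"
    have "x \<bullet> ((- lyap (A - mat s) (mat 1)) *v x) > 0" if "x \<noteq> 0" for x
    proof -
      have "x \<bullet> (C *v x) \<le> norm x * (norm C * norm x)"
        by (meson Cauchy_Schwarz_ineq2 abs_le_D1 order_trans mult_left_mono norm_ge_zero norm_matrix_vector)
      also have "\<dots> = norm C * (x \<bullet> x)"
        by (simp add: dot_square_norm power2_eq_square)
      also have "\<dots> < 2 * s * (x \<bullet> x)"
        using that by (intro mult_strict_right_mono) (auto simp: s_def add_nonneg_pos)
      finally show ?thesis
        unfolding shift C_def[symmetric] by (simp add: mat_vec inner_diff_right)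
    qed
    then have "pos_def (- lyap (A - mat s) (mat 1))"
      by (simp add: pos_def_def)
    then show ?thesis
      using pos_def_mat_1 unfolding L_def by (intro exI[of _ s]) (auto simp: s_def)
  qed
  define T where "T = {s. 0 \<le> s \<and> L s}"
  define s0 where "s0 = Inf T"
  have T: "T \<noteq> {}" "bdd_below T"
    using \<open>\<exists>s\<ge>0. L s\<close> by (auto simp: T_def intro!: bdd_belowI[of _ 0])
  have s0: "s0 \<ge> 0"
    unfolding s0_def using T(1) by (intro cInf_greatest) (auto simp: T_def)
  have "hurwitz (A - mat s0)"
    unfolding hurwitz_iff
  proof clarify
    fix a b \<alpha> \<omega>
    assume "(A - mat s0) *v a = \<alpha> *\<^sub>R a - \<omega> *\<^sub>R b" "(A - mat s0) *v b = \<alpha> *\<^sub>R b + \<omega> *\<^sub>R a" "\<alpha> \<ge> (0::real)"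
    moreover have "mat s0 *v x = s0 *\<^sub>R x" for x :: "real^'n"
      by (simp add: mat_def vec_eq_iff matrix_vector_mult_def if_distrib[of "\<lambda>x. x * _"] cong: if_cong)
    ultimately have "A *v a = (\<alpha> + s0) *\<^sub>R a - \<omega> *\<^sub>R b" "A *v b = (\<alpha> + s0) *\<^sub>R b + \<omega> *\<^sub>R a"
      by (simp_all add: mat_vec algebra_simps)
    moreover have "\<alpha> + s0 \<ge> 0" using s0 \<open>\<alpha> \<ge> 0\<close> by simp
    ultimately show "a = 0 \<and> b = 0"
      using assms unfolding hurwitz_iff by blast
  qed
  \<comment> \<open>A single \<open>X\<close>, solved for at the critical shift, serves all shifts
    close to it.\<close>
  then obtain X where X: "sym_mat X" "lyap (A - mat s0) X = - mat 1"
    using lyap_solve[of "A - mat s0" "- mat 1"] by auto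
  have shiftX: "- lyap (A - mat s) X = mat 1 + (2 * (s - s0)) *\<^sub>R X" for s
    using X(2) unfolding shift by (simp add: algebra_simps)
  have "((\<lambda>r. mat 1 + r *\<^sub>R X) \<longlongrightarrow> mat 1 + 0 *\<^sub>R X) (at 0)"
    by (intro tendsto_intros)
  then have "\<forall>\<^sub>F r in at 0. pos_def (mat 1 + r *\<^sub>R X)"
    by (intro pos_def_eventually[of "mat 1"]) (simp_all add: pos_def_mat_1 X)
  then obtain e where e: "e > 0" "\<And>r. r \<noteq> 0 \<Longrightarrow> dist r 0 < e \<Longrightarrow> pos_def (mat 1 + r *\<^sub>R X)"
    unfolding eventually_at by blast
  have pd: "pos_def (mat 1 + r *\<^sub>R X)" if "\<bar>r\<bar> < e" for r
    using e(2)[of r] that by (cases "r = 0") (auto simp: pos_def_mat_1)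
  \<comment> \<open>At an admissible shift this close, \<open>X\<close> still satisfies the strict
    inequality (the shift enters doubled), and the definite Lyapunov matrix available there forces
    \<open>X\<close> to be semidefinite.\<close>
  obtain s where s: "s \<in> T" "s < s0 + e / 2"
    using cInf_lessD[OF T(1), of "s0 + e / 2"] e(1) by (auto simp: s0_def)
  have "s \<ge> s0" unfolding s0_def using s(1) T(2) by (rule cInf_lower)
  then have "pos_def (- lyap (A - mat s) X)"
    unfolding shiftX using s(2) by (intro pd) (simp add: abs_if)
  then have "pos_semidef X"
    using s(1) X(1) pos_def_imp_pos_semidef lyap_inverse_positive[of _ "A - mat s" X]
    unfolding T_def L_def by blast
  moreover have "x = 0" if "X *v x = 0" for x
    using lyap_quadratic_form[OF X(1), of x "A - mat s0"] that unfolding X(2)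
    by (simp add: matrix_vector_minus_left)
  ultimately have Xp: "pos_def X"
    unfolding pos_def_iff_pos_semidef by blast
  have "s0 = 0"
  proof (rule ccontr)
    assume "s0 \<noteq> 0"
    \<comment> \<open>Small enough to keep the inequality strict at \<open>s0 - r\<close>, and at
      most \<open>s0\<close> so that the lowered shift stays nonnegative; this contradicts
      minimality.\<close>
    define r where "r = min s0 (e / 4)"
    have r: "0 < r" "r \<le> s0" "2 * r < e"
      using s0 \<open>s0 \<noteq> 0\<close> e(1) by (auto simp: r_def)
    have "pos_def (- lyap (A - mat (s0 - r)) X)"
      unfolding shiftX using r by (intro pd) (simp add: abs_if)
    then have "s0 - r \<in> T"
      using Xp r unfolding T_def L_def by auto
    then have "s0 \<le> s0 - r"
      using T(2) cInf_lower unfolding s0_def by blast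
    then show False using r by simp
  qed
  then have "pos_def (- lyap A X)"
    using X(2) by (simp add: pos_def_mat_1)
  then show ?thesis using Xp that by blast
qed

lemma lyap_inverse_psd:
  assumes "hurwitz A" "sym_mat X" "pos_semidef (- lyap A X)"
  shows "pos_semidef X"
  using hurwitz_imp_lyap[OF assms(1)] lyap_inverse_positive assms(2,3) by metis

lemma lyap_inverse_pd:
  assumes "hurwitz A" "sym_mat X" "pos_def (- lyap A X)"
  shows "pos_def X"
proof -
  have "x = 0" if "X *v x = 0" for x
    using lyap_quadratic_form[OF assms(2), of x A] that pos_def_pos[OF assms(3), of x]
    by (auto simp add: matrix_vector_minus_left)
  then show ?thesis
    using lyap_inverse_psd[OF assms(1,2)] assms(3) pos_def_imp_pos_semidef pos_def_iff_pos_semidef by blast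
qed

section \<open>Topology of matrix operations\<close>

lemma bounded_bilinear_matrix_mul:
  "bounded_bilinear ((**) :: real^'n^'m \<Rightarrow> real^'k^'n \<Rightarrow> real^'k^'m)"
  unfolding bilinear_conv_bounded_bilinear[symmetric] bilinear_def
  by (auto intro!: linearI simp: matrix_ring)

lemmas tendsto_matrix_mul [tendsto_intros] = bounded_bilinear.tendsto[OF bounded_bilinear_matrix_mul]
lemmas continuous_on_matrix_mul [continuous_intros] = bounded_bilinear.continuous_on[OF bounded_bilinear_matrix_mul]

lemma bounded_linear_transpose: "bounded_linear (transpose :: real^'n^'m \<Rightarrow> real^'m^'n)"
  by (intro linear_conv_bounded_linear[THEN iffD1] linearI) (simp_all add: matrix_ring)

lemmas tendsto_transpose [tendsto_intros] = bounded_linear.tendsto[OF bounded_linear_transpose]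
lemmas continuous_on_transpose [continuous_intros] = bounded_linear.continuous_on[OF bounded_linear_transpose]

lemma trace_scaleR: "trace (c *\<^sub>R A) = c * trace A" for A :: "real^'n^'n"
  by (simp add: trace_def sum_distrib_left)

lemma trace_minus: "trace (- A) = - trace A" for A :: "real^'n^'n"
  by (simp add: trace_def sum_negf)

lemma bounded_linear_trace: "bounded_linear (trace :: real^'n^'n \<Rightarrow> real)"
  by (intro linear_conv_bounded_linear[THEN iffD1] linearI) (simp_all add: trace_add trace_scaleR)

lemmas tendsto_trace [tendsto_intros] = bounded_linear.tendsto[OF bounded_linear_trace]
lemmas continuous_on_trace [continuous_intros] = bounded_linear.continuous_on[OF bounded_linear_trace]

lemma continuous_on_matrix_vector [continuous_intros]:
  "continuous_on T f \<Longrightarrow> continuous_on T (\<lambda>t. f t *v x)" for f :: "'a::topological_space \<Rightarrow> real^'n^'m"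
  by (rule bounded_linear.continuous_on[of "\<lambda>A. A *v x"])
     (auto intro!: linear_conv_bounded_linear[THEN iffD1] linearI simp: mat_vec)

lemma closed_sym_mat: "closed {M :: real^'n^'n. sym_mat M}"
  unfolding sym_mat_def by (intro closed_Collect_eq continuous_intros)

lemma closed_pos_semidef: "closed {M :: real^'n^'n. pos_semidef M}"
proof -
  have "{M :: real^'n^'n. pos_semidef M} = {M. sym_mat M} \<inter> (\<Inter>x. {M. 0 \<le> x \<bullet> (M *v x)})"
    by (auto simp: pos_semidef_def)
  moreover have "closed {M :: real^'n^'n. 0 \<le> x \<bullet> (M *v x)}" for x
    by (intro closed_Collect_le continuous_intros)
  ultimately show ?thesis
    by (simp add: closed_sym_mat closed_INT closed_Int)
qed

lemma closed_pos_semidef_vimage: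
  fixes f :: "real^'n^'n \<Rightarrow> real^'n^'n"
  assumes "continuous_on UNIV f"
  shows "closed {X. pos_semidef (f X)}"
  using closed_vimage[OF closed_pos_semidef assms] by (simp add: vimage_def)

section \<open>Norm bounds for semidefinite matrices\<close>

lemma matrix_entry: "M $ i $ j = axis i 1 \<bullet> (M *v axis j 1)" for M :: "real^'n^'m"
  by (simp add: matrix_vector_mult_basis inner_axis' column_def)

text \<open>Evaluate the form at e_i + e_j and e_i - e_j; the diagonal entries are nonnegative and
  so at most the trace.\<close>

lemma pos_semidef_entry_le_trace:
  fixes M :: "real^'n^'n"
  assumes "pos_semidef M"
  shows "\<bar>M $ i $ j\<bar> \<le> trace M"
proof -
  have diag: "M $ k $ k \<ge> 0" for k
    unfolding matrix_entry using assms by (rule pos_semidef_nonneg)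
  have "M $ j $ i = transpose M $ i $ j" by (simp add: transpose_def)
  then have sym: "M $ j $ i = M $ i $ j"
    using assms by (simp add: pos_semidef_def sym_mat_def)
  have le: "M $ k $ k \<le> trace M" for k
    unfolding trace_def using diag by (intro member_le_sum) auto
  have "(axis i 1 + axis j s) \<bullet> (M *v (axis i 1 + axis j s)) = M $ i $ i + 2 * s * M $ i $ j + s\<^sup>2 * M $ j $ j" for s
  proof -
    have "axis j s = s *\<^sub>R axis j (1::real)" by (simp add: axis_def vec_eq_iff)
    then show ?thesis
      by (simp add: mat_vec inner_add_left inner_add_right matrix_entry[symmetric] sym power2_eq_square algebra_simps)
  qed
  then have "0 \<le> M $ i $ i + 2 * s * M $ i $ j + s\<^sup>2 * M $ j $ j" for s
    using pos_semidef_nonneg[OF assms] by metis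
  from this[of 1] this[of "-1"]
  have "0 \<le> M $ i $ i + 2 * M $ i $ j + M $ j $ j" "0 \<le> M $ i $ i - 2 * M $ i $ j + M $ j $ j"
    by simp_all
  then show ?thesis using le[of i] le[of j] by linarith
qed

lemma pos_semidef_trace_nonneg: "pos_semidef M \<Longrightarrow> trace M \<ge> 0"
  using pos_semidef_entry_le_trace[of M undefined undefined] by linarith

lemma pos_semidef_norm_le_trace:
  fixes M :: "real^'n^'n"
  assumes "pos_semidef M"
  shows "norm M \<le> (real CARD('n))\<^sup>2 * trace M"
proof -
  have "norm M \<le> (\<Sum>i\<in>UNIV. norm (M $ i))"
    unfolding norm_vec_def[of M] by (intro L2_set_le_sum) auto
  also have "\<dots> \<le> (\<Sum>i\<in>(UNIV::'n set). \<Sum>j\<in>(UNIV::'n set). trace M)"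
    by (intro sum_mono order_trans[OF norm_le_l1_cart] pos_semidef_entry_le_trace assms)
  finally show ?thesis by (simp add: power2_eq_square mult.assoc)
qed

text \<open>Turns the order bounds -E \<le> D \<le> E into a norm bound linear in E, as the
  continuity argument requires.\<close>

lemma norm_le_of_sandwich:
  fixes D E :: "real^'n^'n"
  assumes "pos_semidef (E - D)" "pos_semidef (E + D)"
  shows "norm D \<le> norm E + (real CARD('n))\<^sup>2 * (2 * trace E)"
proof -
  have "trace (E - D) \<le> 2 * trace E"
    using pos_semidef_trace_nonneg[OF assms(2)] by (simp add: trace_add trace_sub)
  then have "norm (E - D) \<le> (real CARD('n))\<^sup>2 * (2 * trace E)"
    using pos_semidef_norm_le_trace[OF assms(1)] by (meson mult_left_mono order_trans zero_le_power2)
  moreover have "norm D \<le> norm E + norm (E - D)"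
    by norm
  ultimately show ?thesis by linarith
qed

section \<open>Riccati equations\<close>

definition ric :: "real^'n^'n \<Rightarrow> real^'n^'n \<Rightarrow> real^'n^'n \<Rightarrow> real^'n^'n \<Rightarrow> real^'n^'n" where
  "ric A S V X = lyap A X + X ** S ** X + V"

text \<open>No definiteness is imposed, so that this covers the equation of a gain, its dual with
  the transposed matrix, the game equation with indefinite quadratic term, and matrix square
  roots.\<close>

definition stab_ric :: "real^'n^'n \<Rightarrow> real^'n^'n \<Rightarrow> real^'n^'n \<Rightarrow> real^'n^'n \<Rightarrow> bool" where
  "stab_ric A S V X \<longleftrightarrow> sym_mat X \<and> ric A S V X = 0 \<and> hurwitz (A + X ** S)"

lemma sym_mat_mul_sandwich [simp]: "sym_mat S \<Longrightarrow> sym_mat X \<Longrightarrow> sym_mat (X ** S ** X)"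
  by (simp add: sym_mat_def matrix_ring)

lemma sym_ric [simp]: "sym_mat S \<Longrightarrow> sym_mat V \<Longrightarrow> sym_mat X \<Longrightarrow> sym_mat (ric A S V X)"
  by (simp add: ric_def)

text \<open>The Taylor expansion is exact at second order, and its linear part is the Lyapunov
  operator of the closed-loop matrix.\<close>

lemma ric_add:
  assumes "sym_mat S" "sym_mat X"
  shows "ric A S V (X + D) = ric A S V X + lyap (A + X ** S) D + D ** S ** D"
  using assms by (simp add: ric_def lyap_def matrix_ring sym_mat_def algebra_simps)

text \<open>The difference of two solutions solves a Sylvester equation whose coefficients are the
  two closed-loop matrices.\<close>

lemma stab_ric_unique:
  assumes "sym_mat S" "stab_ric A S V X" "stab_ric A S V Y"
  shows "X = Y"
proof -
  have X: "transpose X = X" "ric A S V X = 0" "hurwitz (A + X ** S)"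
   and Y: "transpose Y = Y" "ric A S V Y = 0" "hurwitz (transpose (A + Y ** S))"
    using assms(2,3) unfolding stab_ric_def sym_mat_def hurwitz_transpose by auto
  have "(A + X ** S) ** (X - Y) + (X - Y) ** transpose (A + Y ** S) = ric A S V X - ric A S V Y"
    using X(1) Y(1) assms(1) by (simp add: ric_def lyap_def matrix_ring sym_mat_def algebra_simps)
  then have "(A + X ** S) ** (X - Y) + (X - Y) ** transpose (A + Y ** S) = 0"
    by (simp only: X(2) Y(2) diff_self)
  then have "X - Y = 0"
    by (rule sylvester_injective[OF X(3) Y(3)])
  then show ?thesis by simp
qed

text \<open>The solution maximises the trace among the matrices \<^term>\<open>X\<close> below \<^term>\<open>X0\<close> with semidefinite
  residual: a Newton step stays in this set and increases \<^term>\<open>X\<close> unless the residual vanishes.\<close>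

lemma stab_ric_exists:
  fixes A S V X0 :: "real^'n^'n"
  assumes S: "pos_def S" and V: "sym_mat V" and X0: "sym_mat X0" "pos_def (- ric A S V X0)"
  obtains X where "stab_ric A S V X" "pos_semidef (X0 - X)"
proof -
  have symS: "sym_mat S" using S by (rule pos_def_sym)
  define C where "C = {X. pos_semidef (X0 - X)} \<inter> {X. pos_semidef (ric A S V X)}"
  have symC: "sym_mat X" if "X \<in> C" for X
  proof -
    have "sym_mat (X0 - X)"
      using that by (simp add: C_def pos_semidef_sym)
    from sym_mat_simps(2)[OF X0(1) this] show ?thesis by simp
  qed
  have "C \<noteq> {}"
  proof -
    \<comment> \<open>For a large negative multiple of the identity the quadratic term dominates:
      the rescaled residual tends to \<open>S\<close>, and the multiple ends up below
      \<open>X0\<close>.\<close>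
    define F where "F r = r\<^sup>2 *\<^sub>R ric A S V ((- inverse r) *\<^sub>R mat 1)" for r
    have F: "F r = S - r *\<^sub>R lyap A (mat 1) + r\<^sup>2 *\<^sub>R V" if "r > 0" for r
      using that by (simp add: F_def ric_def lyap_def matrix_ring algebra_simps power2_eq_square)
    have "((\<lambda>r. S - r *\<^sub>R lyap A (mat 1) + r\<^sup>2 *\<^sub>R V) \<longlongrightarrow> S - 0 *\<^sub>R lyap A (mat 1) + 0\<^sup>2 *\<^sub>R V) (at_right 0)"
      by (intro tendsto_intros)
    then have 1: "\<forall>\<^sub>F r in at_right 0. pos_def (S - r *\<^sub>R lyap A (mat 1) + r\<^sup>2 *\<^sub>R V)"
      by (intro pos_def_eventually[OF S]) (simp_all add: V symS)
    have "((\<lambda>r. mat 1 + r *\<^sub>R X0) \<longlongrightarrow> mat 1 + 0 *\<^sub>R X0) (at_right 0)"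
      by (intro tendsto_intros)
    then have 2: "\<forall>\<^sub>F r in at_right (0::real). pos_def (mat 1 + r *\<^sub>R X0)"
      by (intro pos_def_eventually[OF pos_def_mat_1]) (simp_all add: X0)
    have "\<forall>\<^sub>F r in at_right (0::real). r > 0"
      by (simp add: eventually_at_right_less)
    then have "\<forall>\<^sub>F r in at_right (0::real). r > 0 \<and> pos_def (F r) \<and> pos_def (mat 1 + r *\<^sub>R X0)"
      using 1 2 by eventually_elim (simp add: F)
    then obtain r :: real where r: "r > 0" "pos_def (F r)" "pos_def (mat 1 + r *\<^sub>R X0)"
      using eventually_happens'[of "at_right (0::real)"] by auto
    have "pos_semidef (inverse (r\<^sup>2) *\<^sub>R F r)" "pos_semidef (inverse r *\<^sub>R (mat 1 + r *\<^sub>R X0))"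
      using r by (simp_all add: pos_semidef_scaleR pos_def_imp_pos_semidef)
    moreover have "inverse (r\<^sup>2) *\<^sub>R F r = ric A S V ((- inverse r) *\<^sub>R mat 1)"
      using r(1) by (simp add: F_def)
    moreover have "inverse r *\<^sub>R (mat 1 + r *\<^sub>R X0) = X0 - (- inverse r) *\<^sub>R mat 1"
      using r(1) by (simp add: algebra_simps)
    ultimately have "(- inverse r) *\<^sub>R mat 1 \<in> C" by (simp add: C_def)
    then show ?thesis by blast
  qed
  then obtain X1 where X1: "X1 \<in> C" by blast
  \<comment> \<open>The trace of the semidefinite \<open>X0 - X\<close> controls its norm, so a
    lower bound on the trace of \<open>X\<close> makes the set compact.\<close>
  define C' where "C' = C \<inter> {X. trace X1 \<le> trace X}"
  have "closed C'"
    unfolding C'_def C_def ric_def lyap_def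
    by (intro closed_Int closed_pos_semidef_vimage closed_Collect_le continuous_intros)
  moreover have "bounded C'"
  proof (rule boundedI)
    fix X assume X: "X \<in> C'"
    have "norm (X0 - X) \<le> (real CARD('n))\<^sup>2 * trace (X0 - X)"
      using X by (intro pos_semidef_norm_le_trace) (auto simp: C'_def C_def)
    also have "\<dots> \<le> (real CARD('n))\<^sup>2 * trace (X0 - X1)"
      using X by (intro mult_left_mono) (auto simp: C'_def trace_sub)
    finally have "norm (X0 - X) \<le> (real CARD('n))\<^sup>2 * trace (X0 - X1)" .
    moreover have "norm X \<le> norm X0 + norm (X0 - X)" by norm
    ultimately show "norm X \<le> norm X0 + (real CARD('n))\<^sup>2 * trace (X0 - X1)"
      by linarith
  qed
  ultimately have "compact C'" by (simp add: compact_eq_bounded_closed)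
  moreover have "C' \<noteq> {}" using X1 by (auto simp: C'_def)
  moreover have "continuous_on C' trace" by (intro continuous_intros)
  ultimately obtain X where X: "X \<in> C'" and max: "\<And>Y. Y \<in> C' \<Longrightarrow> trace Y \<le> trace X"
    using continuous_attains_sup[of C' trace] by blast
  have symX: "sym_mat X" using X symC by (simp add: C'_def)
  define D where "D = X0 - X"
  have D: "pos_semidef D" and rX: "pos_semidef (ric A S V X)"
    using X by (simp_all add: C'_def C_def D_def)
  have DSD: "pos_semidef (D ** S ** D)"
    using S D by (simp add: pos_semidef_sandwich pos_def_imp_pos_semidef pos_semidef_sym)
  have rX0: "ric A S V X0 = ric A S V X + lyap (A + X ** S) D + D ** S ** D"
    using ric_add[OF symS symX, of A V D] by (simp add: D_def)
  \<comment> \<open>Strictness at \<open>X0\<close> makes \<open>D\<close> a Lyapunov certificate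
    for \<open>A + X ** S\<close>, so stability holds for every member of \<open>C\<close>, before
    the residual is known to vanish.\<close>
  have "- lyap (A + X ** S) D = - ric A S V X0 + (ric A S V X + D ** S ** D)"
    unfolding rX0 by (simp add: algebra_simps)
  moreover have "pos_def (- ric A S V X0 + (ric A S V X + D ** S ** D))"
    using X0(2) rX DSD by (intro pos_def_add_pos_semidef pos_semidef_add)
  ultimately have hur: "hurwitz (A + X ** S)"
    using D lyap_imp_hurwitz by metis
  have "sym_mat (- ric A S V X)" using symS V symX by simp
  with hur obtain E where E: "sym_mat E" "lyap (A + X ** S) E = - ric A S V X"
    using lyap_solve by blast
  have psdE: "pos_semidef E"
    by (rule lyap_inverse_psd[OF hur E(1)]) (simp add: E(2) rX)
  have rXE: "ric A S V (X + E) = E ** S ** E"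
    unfolding ric_add[OF symS symX] E(2) by simp
  then have "pos_semidef (ric A S V (X + E))"
    using S E(1) by (simp add: pos_semidef_sandwich pos_def_imp_pos_semidef)
  moreover have "pos_semidef (X0 - (X + E))"
  proof -
    \<comment> \<open>The Newton step cancels the residual of \<open>X\<close>, leaving the strict
      residual of \<open>X0\<close> and a square.\<close>
    have "- lyap (A + X ** S) (D - E) = - ric A S V X0 + D ** S ** D"
      unfolding rX0 by (simp add: lyap_diff E(2))
    moreover have "pos_def (- ric A S V X0 + D ** S ** D)"
      using X0(2) DSD by (intro pos_def_add_pos_semidef)
    ultimately have "pos_semidef (D - E)"
      using lyap_inverse_psd[OF hur, of "D - E"] E(1) D by (simp add: pos_def_imp_pos_semidef pos_semidef_sym)
    then show ?thesis by (simp add: D_def algebra_simps)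
  qed
  moreover have "trace X1 \<le> trace (X + E)"
    using X pos_semidef_trace_nonneg[OF psdE] by (simp add: C'_def trace_add)
  ultimately have "X + E \<in> C'" by (simp add: C'_def C_def)
  from max[OF this] have "trace E \<le> 0" by (simp add: trace_add)
  then have "trace E = 0" using pos_semidef_trace_nonneg[OF psdE] by linarith
  then have "E = 0" using pos_semidef_norm_le_trace[OF psdE] by simp
  then have "ric A S V X = 0" using E(2) by (simp add: lyap_def)
  then have "stab_ric A S V X" using symX hur by (simp add: stab_ric_def)
  then show ?thesis using that D by (simp add: D_def)
qed

lemma ric_neg: "ric (- A) S V (- X) = ric A S V X"
  by (simp add: ric_def lyap_def matrix_ring)

text \<open>Changing the signs of \<open>A\<close> and \<open>X\<close> preserves the residual but
  reverses stability and order, so this solution lies above \<open>X0\<close>.\<close>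

lemma antistab_ric_exists:
  fixes A S V X0 :: "real^'n^'n"
  assumes "pos_def S" "sym_mat V" "sym_mat X0" "pos_def (- ric A S V X0)"
  obtains N where "sym_mat N" "ric A S V N = 0" "hurwitz (- (A + N ** S))" "pos_semidef (N - X0)"
proof -
  obtain X where X: "stab_ric (- A) S V X" "pos_semidef (- X0 - X)"
    using stab_ric_exists[of S V "- X0" "- A"] assms by (auto simp: ric_neg)
  have "- X0 - X = - X - X0" by simp
  with X(2) have "pos_semidef (- X - X0)" by metis
  moreover have "sym_mat (- X)" "ric A S V (- X) = 0" "hurwitz (- (A + (- X) ** S))"
    using X(1) ric_neg[of A S V "- X"] by (simp_all add: stab_ric_def matrix_minus_left algebra_simps)
  ultimately show ?thesis using that by blast
qed

text \<open>Along \<open>D\<close> the residual is -e times the identity plus a term of order e^2.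
  This is the converse of \<open>stab_ric_exists\<close> and allows passage between equations and
  strict inequalities.\<close>

lemma stab_ric_imp_strict:
  assumes "sym_mat S" "sym_mat V" "stab_ric A S V X"
  obtains D where "pos_def D" "lyap (A + X ** S) D = - mat 1"
    "\<forall>\<^sub>F e in at_right 0. pos_def (- ric A S V (X + e *\<^sub>R D))"
proof -
  have X: "sym_mat X" "ric A S V X = 0" "hurwitz (A + X ** S)"
    using assms(3) by (simp_all add: stab_ric_def)
  obtain D where D: "sym_mat D" "lyap (A + X ** S) D = - mat 1"
    using lyap_solve[OF X(3), of "- mat 1"] by auto
  have "pos_def D"
    using lyap_inverse_pd[OF X(3) D(1)] D(2) by (simp add: pos_def_mat_1)
  moreover have "\<forall>\<^sub>F e in at_right 0. pos_def (- ric A S V (X + e *\<^sub>R D))"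
  proof -
    have eq: "- ric A S V (X + e *\<^sub>R D) = e *\<^sub>R (mat 1 - e *\<^sub>R (D ** S ** D))" for e
      by (simp add: ric_add[OF assms(1) X(1)] X(2) lyap_scaleR D(2) matrix_ring algebra_simps)
    have "((\<lambda>e. mat 1 - e *\<^sub>R (D ** S ** D)) \<longlongrightarrow> mat 1 - 0 *\<^sub>R (D ** S ** D)) (at_right 0)"
      by (intro tendsto_intros)
    then have "\<forall>\<^sub>F e in at_right (0::real). pos_def (mat 1 - e *\<^sub>R (D ** S ** D))"
      by (intro pos_def_eventually[OF pos_def_mat_1]) (simp_all add: assms D)
    moreover have "\<forall>\<^sub>F e in at_right (0::real). e > 0"
      by (simp add: eventually_at_right_less)
    ultimately show ?thesis
      by eventually_elim (simp add: eq pos_def_scaleR)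
  qed
  ultimately show ?thesis using that D(2) by blast
qed

text \<open>With \<open>A = 0\<close> the Riccati equation reads X^2 = Q, and -X is a semidefinite
  root. Any semidefinite root Y of a definite matrix is definite, so -Y is Hurwitz and uniqueness of
  stabilizing solutions settles the definite description.\<close>

lemma mat_sqrt:
  assumes "pos_def Q"
  shows "pos_semidef (mat_sqrt Q)" "mat_sqrt Q ** mat_sqrt Q = Q"
proof -
  have ric0: "ric 0 (mat 1) (- Q) X = X ** X - Q" for X
    by (simp add: ric_def lyap_def)
  obtain X where X: "stab_ric 0 (mat 1) (- Q) X" "pos_semidef (0 - X)"
    using stab_ric_exists[of "mat 1" "- Q" 0 0] assms
    by (auto simp: ric0 pos_def_mat_1 pos_def_sym)
  have ex: "pos_semidef (- X) \<and> (- X) ** (- X) = Q"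
    using X by (simp add: stab_ric_def ric0 matrix_minus_left matrix_minus_right)
  have "Y = - X" if Y: "pos_semidef Y \<and> Y ** Y = Q" for Y
  proof -
    have "x = 0" if "Y *v x = 0" for x
    proof -
      have "Q *v x = 0" using Y that by (metis matrix_vector_mul_assoc matrix_vector_mult_0_right)
      then show ?thesis using assms by (simp add: pos_def_iff_pos_semidef)
    qed
    then have "pos_def (2 *\<^sub>R Y)"
      using Y by (intro pos_def_scaleR) (auto simp: pos_def_iff_pos_semidef)
    moreover have "- lyap (- Y) (mat 1) = 2 *\<^sub>R Y"
      using Y by (simp add: lyap_def transpose_minus pos_semidef_def sym_mat_def scaleR_2)
    ultimately have "hurwitz (- Y)"
      using lyap_imp_hurwitz[of "mat 1" "- Y"] pos_def_imp_pos_semidef[OF pos_def_mat_1] by metis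
    then have "stab_ric 0 (mat 1) (- Q) (- Y)"
      using Y by (simp add: stab_ric_def ric0 matrix_minus_left matrix_minus_right pos_semidef_sym)
    then have "- Y = X"
      using X(1) stab_ric_unique[of "mat 1"] by simp
    then show ?thesis by (metis minus_minus)
  qed
  with ex have "mat_sqrt Q = - X"
    unfolding mat_sqrt_def by (rule the_equality)
  then show "pos_semidef (mat_sqrt Q)" "mat_sqrt Q ** mat_sqrt Q = Q"
    using ex by simp_all
qed

section \<open>Limits of Hurwitz matrices\<close>

lemma linear_factors_product:
  fixes a b :: "'i \<Rightarrow> 'a::comm_ring_1"
  assumes "finite I"
  shows "degree (\<Prod>i\<in>I. [:a i, b i:]) \<le> card I \<and> coeff (\<Prod>i\<in>I. [:a i, b i:]) (card I) = (\<Prod>i\<in>I. b i)"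
  using assms
proof induction
  case (insert k I)
  define q where "q = (\<Prod>i\<in>I. [:a i, b i:])"
  have q: "degree q \<le> card I" "coeff q (card I) = (\<Prod>i\<in>I. b i)"
    using insert.IH by (simp_all add: q_def)
  have "degree ([:a k, b k:] * q) \<le> degree [:a k, b k:] + degree q"
    by (rule degree_mult_le)
  also have "\<dots> \<le> 1 + card I"
    using q(1) by (intro add_mono) auto
  finally have "degree ([:a k, b k:] * q) \<le> Suc (card I)" by simp
  moreover have "coeff q (Suc (card I)) = 0"
    using q(1) by (intro coeff_eq_0) auto
  ultimately show ?case
    using insert.hyps q by (simp add: q_def)
qed simp

text \<open>Take the determinant of a matrix of linear polynomials. The leading coefficients of its
  permutation summands add up to the determinant of the identity, which makes it monic.\<close>

lemma char_poly_exists: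
  fixes M :: "complex^'n^'n"
  obtains p where "lead_coeff p = 1" "degree p = CARD('n)" "\<And>z. poly p z = det (mat z - M)"
proof -
  define PM where "PM = (\<chi> i j. [:- M $ i $ j, if i = j then 1 else 0:])"
  define p where "p = det PM"
  let ?n = "CARD('n)"
  have summand: "degree (\<Prod>i\<in>UNIV. PM $ i $ \<sigma> i) \<le> ?n \<and>
     coeff (\<Prod>i\<in>UNIV. PM $ i $ \<sigma> i) ?n = (\<Prod>i\<in>UNIV. (mat 1 :: complex^'n^'n) $ i $ \<sigma> i)" for \<sigma>
    using linear_factors_product[of UNIV "\<lambda>i. - M $ i $ \<sigma> i" "\<lambda>i. if i = \<sigma> i then 1 else 0"]
    by (simp add: PM_def mat_def)
  have sgn: "of_int k = [:of_int k:]" for k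
    by (simp add: of_int_poly)
  have "degree p \<le> ?n"
    unfolding p_def det_def
    by (intro degree_sum_le) (auto simp: sgn intro: order_trans[OF degree_smult_le] summand[THEN conjunct1])
  moreover have "coeff p ?n = det (mat 1 :: complex^'n^'n)"
    unfolding p_def det_def coeff_sum
    by (intro sum.cong) (simp_all add: sgn summand)
  then have "coeff p ?n = 1" by simp
  ultimately have "degree p = ?n" "lead_coeff p = 1"
    using le_degree[of p ?n] by auto
  moreover have "poly p z = det (mat z - M)" for z
  proof -
    have "poly (PM $ i $ j) z = (mat z - M) $ i $ j" for i j
      by (simp add: PM_def mat_def)
    then show ?thesis
      unfolding p_def det_def poly_sum poly_mult poly_prod by (simp add: sgn)
  qed
  ultimately show ?thesis using that by blast
qed

text \<open>Every root lies to the left of the imaginary axis, hence at distance at least Re z from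
  z. The bound is independent of \<open>M\<close> and therefore survives limits, in place of
  continuity of eigenvalues.\<close>

lemma hurwitz_det_lower_bound:
  fixes M :: "real^'n^'n"
  assumes "hurwitz M" "Re z > 0"
  shows "norm (det (mat z - cmat M)) \<ge> Re z ^ CARD('n)"
proof -
  obtain p where p: "lead_coeff p = 1" "degree p = CARD('n)" "\<And>z. poly p z = det (mat z - cmat M)"
    using char_poly_exists by blast
  obtain root where r: "p = (\<Prod>i<degree p. [:-root i, 1:])"
    using complex_poly_decompose'[of p] p(1) by (metis smult_1_left)
  have eq: "poly p w = (\<Prod>i<degree p. w - root i)" for w
    by (subst r) (simp add: poly_prod)
  have "Re (root i) < 0" if "i < degree p" for i
    using that assms(1) p(3)[of "root i"] unfolding hurwitz_def eq by (metis (no_types, lifting) finite_lessThan lessThan_iff prod_zero_iff right_minus_eq)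
  then have "Re z \<le> norm (z - root i)" if "i < degree p" for i
    using that complex_Re_le_cmod[of "z - root i"] by fastforce
  then have "(\<Prod>i<degree p. Re z) \<le> (\<Prod>i<degree p. norm (z - root i))"
    using assms(2) by (intro prod_mono) auto
  then show ?thesis
    by (simp add: p(3)[symmetric] eq prod_norm p(2))
qed

text \<open>Only the open right half-plane is excluded: eigenvalues may reach the imaginary axis in
  the limit, and there the gain bound has to take over.\<close>

lemma hurwitz_limit:
  fixes M :: "real^'n^'n"
  assumes "\<And>k::nat. hurwitz (f k)" "f \<longlonglongrightarrow> M"
    and "M *v a = \<alpha> *\<^sub>R a - \<omega> *\<^sub>R b" "M *v b = \<alpha> *\<^sub>R b + \<omega> *\<^sub>R a" "\<alpha> > 0"
  shows "a = 0 \<and> b = 0"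
proof (rule ccontr)
  assume ne: "\<not> ?thesis"
  define z where "z = Complex \<alpha> \<omega>"
  have "det (mat z - cmat M) = 0"
    unfolding det_mat_minus_cmat_eq_0_iff using ne assms(3,4)
    by (intro exI[of _ a] exI[of _ b]) (simp add: z_def)
  moreover have "(\<lambda>k. det (mat z - cmat (f k))) \<longlonglongrightarrow> det (mat z - cmat M)"
    unfolding det_def cmat_def using assms(2)
    by (auto intro!: tendsto_intros)
  then have "(\<lambda>k. norm (det (mat z - cmat (f k)))) \<longlonglongrightarrow> norm (det (mat z - cmat M))"
    by (rule tendsto_norm)
  then have "\<alpha> ^ CARD('n) \<le> norm (det (mat z - cmat M))"
    using hurwitz_det_lower_bound[OF assms(1), of z] assms(5)
    by (intro LIMSEQ_le_const[of "\<lambda>k. norm (det (mat z - cmat (f k)))"]) (auto simp: z_def)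
  ultimately show False using zero_less_power[OF assms(5), of "CARD('n)"] by simp
qed

section \<open>The bounded real lemma\<close>

lemma inner_cvec: "cvec a b \<bullet> cvec c d = a \<bullet> c + b \<bullet> d"
  by (simp add: cvec_def inner_vec_def inner_complex_def sum.distrib)

lemma sandwich_quadratic_form:
  fixes C :: "real^'n^'m"
  assumes "sym_mat X"
  shows "x \<bullet> ((X ** (C ** transpose C) ** X) *v x) = (norm (transpose C *v (X *v x)))\<^sup>2"
proof -
  have "x \<bullet> ((X ** (C ** transpose C) ** X) *v x) = x \<bullet> (X *v (C *v (transpose C *v (X *v x))))"
    by (simp only: matrix_vector_mul_assoc[symmetric])
  also have "\<dots> = (transpose C *v (X *v x)) \<bullet> (transpose C *v (X *v x))"
    using assms by (simp only: inner_matrix_vector[of x X] inner_matrix_vector[of "X *v x" C] sym_matD)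
  finally show ?thesis by (simp only: power2_norm_eq_inner)
qed

text \<open>\<open>CS\<close> is C^T C = S in inner-product form, convenient for a stacked output
  matrix.\<close>

locale transfer =
  fixes A S Bw :: "real^'n^'n" and C :: "real^'n^'p"
  assumes A: "hurwitz A" and S: "pos_def S"
    and CS: "\<And>x y. (C *v x) \<bullet> (C *v y) = x \<bullet> (S *v y)"
begin

definition T :: "real \<Rightarrow> complex^'n^'p" where
  "T \<omega> = cmat C ** matrix_inv (mat (\<i> * complex_of_real \<omega>) - cmat A) ** cmat Bw"

lemma transfer_state:
  obtains g1 g2 where "T \<omega> *v cvec v1 v2 = cvec (C *v g1) (C *v g2)"
    "A *v g1 = - \<omega> *\<^sub>R g2 - Bw *v v1" "A *v g2 = \<omega> *\<^sub>R g1 - Bw *v v2"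
proof -
  define D where "D = mat (\<i> * complex_of_real \<omega>) - cmat A"
  have "det D \<noteq> 0" using A unfolding hurwitz_def D_def by force
  obtain g1 g2 where g: "matrix_inv D *v (cmat Bw *v cvec v1 v2) = cvec g1 g2"
    by (rule cvec_cases)
  have "D *v cvec g1 g2 = cmat Bw *v cvec v1 v2"
    unfolding g[symmetric] using invertible_inv(2)[OF \<open>det D \<noteq> 0\<close>] by (simp add: matrix_vector_mul_assoc matrix_mul_assoc)
  then have "- \<omega> *\<^sub>R g2 - A *v g1 = Bw *v v1" "\<omega> *\<^sub>R g1 - A *v g2 = Bw *v v2"
    by (simp_all add: D_def matrix_vector_mult_diff_rdistrib mat_cvec cmat_cvec cvec_diff)
  then have "A *v g1 = - \<omega> *\<^sub>R g2 - Bw *v v1" "A *v g2 = \<omega> *\<^sub>R g1 - Bw *v v2"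
    by (simp_all add: algebra_simps)
  moreover have "T \<omega> *v cvec v1 v2 = cvec (C *v g1) (C *v g2)"
    by (simp only: T_def D_def[symmetric] matrix_vector_mul_assoc[symmetric] g) (simp only: cmat_cvec)
  ultimately show ?thesis using that by blast
qed

text \<open>A dissipation inequality with storage matrix \<open>P\<close>. At a fixed frequency the
  frequency terms cancel by symmetry of \<open>P\<close>, so output energy is bounded by the
  supply.\<close>

lemma norm_transfer_le:
  fixes P :: "real^'n^'n"
  assumes P: "sym_mat P" and b: "b > 0"
    and ineq: "pos_semidef (- (lyap (transpose A) P + S + inverse (b\<^sup>2) *\<^sub>R (P ** (Bw ** transpose Bw) ** P)))"
  shows "norm (T \<omega> *v v) \<le> b * norm v"
proof -
  obtain v1 v2 where v: "v = cvec v1 v2" by (rule cvec_cases)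
  obtain g1 g2 where g: "T \<omega> *v cvec v1 v2 = cvec (C *v g1) (C *v g2)"
    "A *v g1 = - \<omega> *\<^sub>R g2 - Bw *v v1" "A *v g2 = \<omega> *\<^sub>R g1 - Bw *v v2"
    by (rule transfer_state)
  define p where "p x = transpose Bw *v (P *v x)" for x
  have bound: "2 * ((A *v x) \<bullet> (P *v x)) + x \<bullet> (S *v x) + inverse (b\<^sup>2) * (norm (p x))\<^sup>2 \<le> 0" for x
    using pos_semidef_nonneg[OF ineq, of x]
    by (simp only: mat_vec inner_add_right inner_minus_right lyap_quadratic_form[OF P] transpose_transpose
        inner_scaleR_right p_def sandwich_quadratic_form[OF P, unfolded mat_vec] neg_0_le_iff_le)
  have sym: "g1 \<bullet> (P *v g2) = g2 \<bullet> (P *v g1)"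
    using P by (simp only: inner_matrix_vector[of g1 P] sym_matD inner_commute)
  have Bp: "(Bw *v w) \<bullet> (P *v x) = w \<bullet> p x" for w x
    by (simp only: inner_matrix_vector_left p_def)
  have "2 * ((A *v g1) \<bullet> (P *v g1)) + 2 * ((A *v g2) \<bullet> (P *v g2)) = - 2 * (v1 \<bullet> p g1) - 2 * (v2 \<bullet> p g2)"
    by (simp add: g inner_diff_left Bp sym algebra_simps)
  then have le: "g1 \<bullet> (S *v g1) + g2 \<bullet> (S *v g2) \<le>
      (2 * (v1 \<bullet> p g1) - inverse (b\<^sup>2) * (norm (p g1))\<^sup>2) + (2 * (v2 \<bullet> p g2) - inverse (b\<^sup>2) * (norm (p g2))\<^sup>2)"
    using bound[of g1] bound[of g2] by linarith
  \<comment> \<open>Complete the square in b w - q / b, which eliminates the unknown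
    \<open>q\<close>.\<close>
  have sq: "2 * (w \<bullet> q) - inverse (b\<^sup>2) * (norm q)\<^sup>2 \<le> b\<^sup>2 * (norm w)\<^sup>2" for w q :: "real^'n"
  proof -
    have "0 \<le> (norm (b *\<^sub>R w - inverse b *\<^sub>R q))\<^sup>2" by simp
    also have "\<dots> = b\<^sup>2 * (norm w)\<^sup>2 - 2 * (w \<bullet> q) + inverse (b\<^sup>2) * (norm q)\<^sup>2"
      using b unfolding power2_norm_eq_inner
      by (simp add: inner_diff_left inner_diff_right inner_commute power2_eq_square algebra_simps)
    finally show ?thesis by simp
  qed
  have "(norm (T \<omega> *v v))\<^sup>2 = g1 \<bullet> (S *v g1) + g2 \<bullet> (S *v g2)"
    unfolding v g norm_cvec by (simp only: power2_norm_eq_inner CS)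
  also have "\<dots> \<le> b\<^sup>2 * (norm v1)\<^sup>2 + b\<^sup>2 * (norm v2)\<^sup>2"
    using le sq[of v1 "p g1"] sq[of v2 "p g2"] by linarith
  also have "\<dots> = (b * norm v)\<^sup>2"
    by (simp add: v power_mult_distrib norm_cvec algebra_simps)
  finally show ?thesis
    using b by (simp add: power2_le_iff_abs_le)
qed

text \<open>Finiteness of the supremum: a Lyapunov solution with slack \<open>mat 1\<close> absorbs
  the quadratic term once \<open>b\<close> is large.\<close>

lemma norm_transfer_bounded:
  obtains b where "b > 0" "\<And>\<omega> v. norm (T \<omega> *v v) \<le> b * norm v"
proof -
  have symS: "sym_mat S" using S by (rule pos_def_sym)
  obtain P where P: "sym_mat P" "lyap (transpose A) P = - (S + mat 1)"
    using lyap_solve[of "transpose A" "- (S + mat 1)"] A symS by (auto simp: hurwitz_transpose)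
  define G where "G = P ** (Bw ** transpose Bw) ** P"
  have symG: "sym_mat G"
    using P(1) by (simp add: G_def sym_mat_def matrix_ring)
  have "((\<lambda>e. mat 1 - e *\<^sub>R G) \<longlongrightarrow> mat 1 - 0 *\<^sub>R G) (at_right 0)"
    by (intro tendsto_intros)
  then have "\<forall>\<^sub>F e in at_right (0::real). pos_def (mat 1 - e *\<^sub>R G)"
    by (intro pos_def_eventually[OF pos_def_mat_1]) (simp_all add: symG)
  moreover have "\<forall>\<^sub>F e in at_right (0::real). e > 0"
    by (simp add: eventually_at_right_less)
  ultimately have "\<forall>\<^sub>F e in at_right (0::real). e > 0 \<and> pos_def (mat 1 - e *\<^sub>R G)"
    by eventually_elim simp
  then obtain e :: real where e: "e > 0" "pos_def (mat 1 - e *\<^sub>R G)"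
    using eventually_happens'[of "at_right (0::real)"] by auto
  define b where "b = sqrt (inverse e)"
  have b: "b > 0" "inverse (b\<^sup>2) = e" using e(1) by (simp_all add: b_def)
  have "- (lyap (transpose A) P + S + inverse (b\<^sup>2) *\<^sub>R G) = mat 1 - e *\<^sub>R G"
    by (simp add: P(2) b(2))
  then have "norm (T \<omega> *v v) \<le> b * norm v" for \<omega> v
    using norm_transfer_le[OF P(1) b(1)] e(2) pos_def_imp_pos_semidef unfolding G_def by metis
  then show ?thesis using that b(1) by blast
qed

definition hinf :: real where "hinf = (SUP \<omega>. onorm (\<lambda>v. T \<omega> *v v))"

lemma onorm_transfer: "norm (T \<omega> *v v) \<le> onorm (\<lambda>v. T \<omega> *v v) * norm v"
  by (rule onorm) (rule matrix_vector_mul_bounded_linear)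

lemma norm_transfer_le_hinf: "norm (T \<omega> *v v) \<le> hinf * norm v"
proof -
  obtain b where b: "b > 0" "\<And>\<omega> v. norm (T \<omega> *v v) \<le> b * norm v"
    using norm_transfer_bounded by blast
  have "bdd_above (range (\<lambda>\<omega>. onorm (\<lambda>v. T \<omega> *v v)))"
    using b by (intro bdd_aboveI[of _ b]) (auto intro!: onorm_le)
  then have "onorm (\<lambda>v. T \<omega> *v v) \<le> hinf"
    unfolding hinf_def by (rule cSUP_upper[OF UNIV_I])
  then show ?thesis
    using onorm_transfer[of \<omega> v] mult_right_mono[OF _ norm_ge_zero[of v]] order_trans by blast
qed

lemma hinf_nonneg: "hinf \<ge> 0"
proof -
  have "0 \<le> hinf * norm (axis undefined 1 :: complex^'n)"
    using norm_transfer_le_hinf norm_ge_zero order_trans by blast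
  then show ?thesis by simp
qed

text \<open>Bounds at single frequencies give only \<le> for their supremum; the strict inequality
  persists for a slightly smaller \<open>r\<close>, which restores strictness.\<close>

lemma hinf_less:
  fixes P :: "real^'n^'n"
  assumes P: "sym_mat P" and b: "b > 0"
    and ineq: "pos_def (- (lyap (transpose A) P + S + inverse (b\<^sup>2) *\<^sub>R (P ** (Bw ** transpose Bw) ** P)))"
  shows "hinf < b"
proof -
  define G where "G = P ** (Bw ** transpose Bw) ** P"
  define F where "F r = - (lyap (transpose A) P + S + inverse (r\<^sup>2) *\<^sub>R G)" for r
  have symG: "sym_mat G"
    using P(1) by (simp add: G_def sym_mat_def matrix_ring)
  have symF: "sym_mat (F r)" for r
    using P symG pos_def_sym[OF S] by (simp add: F_def)
  have "(F \<longlongrightarrow> F b) (at_left b)"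
    unfolding F_def using b by (intro tendsto_intros) auto
  then have "\<forall>\<^sub>F r in at_left b. pos_def (F r)"
    using ineq by (intro pos_def_eventually[of "F b"]) (simp_all add: symF, simp add: F_def G_def)
  moreover have "\<forall>\<^sub>F r in at_left b. r \<in> {0<..<b}"
    using b by (rule eventually_at_leftI[rotated]) simp
  ultimately have "\<forall>\<^sub>F r in at_left b. 0 < r \<and> r < b \<and> pos_def (F r)"
    by eventually_elim simp
  then obtain r where r: "0 < r" "r < b" "pos_def (F r)"
    using eventually_happens'[of "at_left b"] by auto
  have "norm (T \<omega> *v v) \<le> r * norm v" for \<omega> v
    using norm_transfer_le[OF P r(1)] r(3) pos_def_imp_pos_semidef unfolding F_def G_def by blast
  then have "hinf \<le> r"
    unfolding hinf_def using r(1) by (intro cSUP_least) (auto intro!: onorm_le)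
  with r(2) show ?thesis by simp
qed

end

text \<open>An imaginary eigenvector y of the transposed closed loop yields the input v = Bw^T y,
  nonzero since W is definite. The equation gives b^2 |CXy|^2 \<le> |v|^2, while |v|^2 is the
  pairing of CXy with the response to v, hence at most hinf |CXy| |v|. This contradicts hinf <
  b.\<close>

lemma (in transfer) no_imaginary_eigenvalue:
  fixes X :: "real^'n^'n"
  assumes W: "pos_def (Bw ** transpose Bw)" and b: "hinf < b" and \<theta>: "\<theta> \<le> 1"
    and X: "sym_mat X" "ric A S ((\<theta> * inverse (b\<^sup>2)) *\<^sub>R (Bw ** transpose Bw)) X = 0"
    and y: "transpose (A + X ** S) *v y1 = - \<omega> *\<^sub>R y2" "transpose (A + X ** S) *v y2 = \<omega> *\<^sub>R y1"
  shows "y1 = 0 \<and> y2 = 0"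
proof (rule ccontr)
  assume ne: "\<not> ?thesis"
  have b0: "b > 0" using b hinf_nonneg by linarith
  have symS: "transpose S = S" using S by (simp add: pos_def_sym sym_matD)
  define v where "v x = transpose Bw *v x" for x
  have vv: "x \<bullet> ((Bw ** transpose Bw) *v x) = (norm (v x))\<^sup>2" for x
    by (simp only: matrix_vector_mul_assoc[symmetric] inner_matrix_vector[of x Bw] power2_norm_eq_inner v_def)
  define N where "N = (norm (v y1))\<^sup>2 + (norm (v y2))\<^sup>2"
  define E where "E = (norm (C *v (X *v y1)))\<^sup>2 + (norm (C *v (X *v y2)))\<^sup>2"
  have "N > 0"
  proof -
    have "y1 \<noteq> 0 \<Longrightarrow> (norm (v y1))\<^sup>2 > 0" "y2 \<noteq> 0 \<Longrightarrow> (norm (v y2))\<^sup>2 > 0"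
      using pos_def_pos[OF W] unfolding vv by blast+
    then show ?thesis
      using ne unfolding N_def by (metis add_pos_nonneg add_nonneg_pos zero_le_power2)
  qed
  have ty: "transpose (A + X ** S) *v x = transpose A *v x + S *v (X *v x)" for x
    using X(1) by (simp only: transpose_add matrix_transpose_mul symS sym_matD mat_vec)
  have y1: "transpose A *v y1 = - \<omega> *\<^sub>R y2 - S *v (X *v y1)"
    and y2: "transpose A *v y2 = \<omega> *\<^sub>R y1 - S *v (X *v y2)"
    using y unfolding ty by (simp_all add: algebra_simps)
  have sym: "y2 \<bullet> (X *v y1) = y1 \<bullet> (X *v y2)"
    using X(1) by (simp only: inner_matrix_vector[of y2 X] sym_matD inner_commute)
  have E: "E = (S *v (X *v y1)) \<bullet> (X *v y1) + (S *v (X *v y2)) \<bullet> (X *v y2)"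
    unfolding E_def power2_norm_eq_inner CS by (simp only: inner_commute)
  have quad: "2 * ((transpose A *v x) \<bullet> (X *v x)) + (S *v (X *v x)) \<bullet> (X *v x)
      + \<theta> * inverse (b\<^sup>2) * (norm (v x))\<^sup>2 = 0" for x
  proof -
    have "x \<bullet> (ric A S ((\<theta> * inverse (b\<^sup>2)) *\<^sub>R (Bw ** transpose Bw)) X *v x) = 0"
      by (simp only: X(2) matrix_vector_mult_0 inner_zero_right)
    moreover have "x \<bullet> ((X ** S ** X) *v x) = (S *v (X *v x)) \<bullet> (X *v x)"
      using X(1) by (simp only: matrix_vector_mul_assoc[symmetric] inner_matrix_vector[of x X] sym_matD inner_commute)
    ultimately show ?thesis
      unfolding ric_def matrix_vector_mult_add_rdistrib inner_add_right lyap_quadratic_form[OF X(1)]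
        matrix_vector_scaleR_left inner_scaleR_right vv by simp
  qed
  have "E = \<theta> * inverse (b\<^sup>2) * N"
    using quad[of y1] quad[of y2] sym unfolding E N_def y1 y2
    by (simp add: inner_diff_left algebra_simps)
  also have "\<dots> \<le> inverse (b\<^sup>2) * N"
    using \<theta> \<open>N > 0\<close> b0 by (simp add: divide_right_mono)
  finally have EN: "b\<^sup>2 * E \<le> N"
    using b0 by (simp add: field_simps)
  \<comment> \<open>Passing to the transpose reverses the frequency; with this sign the frequency
    terms cancel in the pairing with \<open>y1\<close> and \<open>y2\<close>.\<close>
  obtain g1 g2 where g: "T (- \<omega>) *v cvec (v y1) (v y2) = cvec (C *v g1) (C *v g2)"
    "A *v g1 = - (- \<omega>) *\<^sub>R g2 - Bw *v v y1" "A *v g2 = (- \<omega>) *\<^sub>R g1 - Bw *v v y2"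
    by (rule transfer_state)
  have Bv: "x \<bullet> (Bw *v v x) = (norm (v x))\<^sup>2" for x
    by (simp only: inner_matrix_vector[of x Bw] power2_norm_eq_inner v_def)
  have Ay: "(transpose A *v x) \<bullet> z = x \<bullet> (A *v z)" for x z
    by (simp only: inner_matrix_vector)
  have SX: "S *v (X *v y1) = - \<omega> *\<^sub>R y2 - transpose A *v y1" "S *v (X *v y2) = \<omega> *\<^sub>R y1 - transpose A *v y2"
    by (simp_all only: y1 y2) simp_all
  have "N = (S *v (X *v y1)) \<bullet> g1 + (S *v (X *v y2)) \<bullet> g2"
    unfolding SX inner_diff_left Ay g(2,3) by (simp add: inner_diff_right Bv N_def)
  also have "\<dots> = cvec (C *v (X *v y1)) (C *v (X *v y2)) \<bullet> cvec (C *v g1) (C *v g2)"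
    unfolding inner_cvec CS by (simp only: inner_matrix_vector[of _ S] symS)
  also have "\<dots> \<le> norm (cvec (C *v (X *v y1)) (C *v (X *v y2))) * norm (T (- \<omega>) *v cvec (v y1) (v y2))"
    unfolding g(1) by (rule norm_cauchy_schwarz)
  also have "\<dots> \<le> norm (cvec (C *v (X *v y1)) (C *v (X *v y2))) * (hinf * norm (cvec (v y1) (v y2)))"
    by (intro mult_left_mono norm_transfer_le_hinf) simp
  also have "\<dots> = sqrt E * (hinf * sqrt N)"
    unfolding E_def N_def norm_cvec[symmetric] by simp
  finally have "sqrt N * sqrt N \<le> (hinf * sqrt E) * sqrt N"
    using \<open>N > 0\<close> by (simp add: mult_ac)
  then have 1: "sqrt N \<le> hinf * sqrt E"
    by (rule mult_right_le_imp_le) (use \<open>N > 0\<close> in simp)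
  then have "E > 0"
    using \<open>N > 0\<close> by (metis E_def add_nonneg_nonneg less_eq_real_def mult_zero_right not_le real_sqrt_gt_zero real_sqrt_zero zero_le_power2)
  then have "sqrt N < b * sqrt E"
    using 1 b by (smt (verit) mult_strict_right_mono real_sqrt_gt_zero)
  then have "sqrt N < sqrt (b\<^sup>2 * E)"
    using b0 by (simp add: real_sqrt_mult)
  then show False using EN by simp
qed

text \<open>As \<open>V\<close> is semidefinite, the definite quadratic term is dominated by the
  linear one, so |Xx| is at most a constant times |x|. The constant depends on \<open>A\<close> and
  \<open>S\<close> alone, hence is uniform along a homotopy in \<open>V\<close>.\<close>

lemma bounded_of_ric_nonpos:
  fixes A S :: "real^'n^'n"
  assumes "pos_def S"
  obtains c where "\<And>X V. sym_mat X \<Longrightarrow> pos_semidef V \<Longrightarrow> ric A S V X = 0 \<Longrightarrow> norm X \<le> c"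
proof -
  obtain s where s: "s > 0" "\<And>x. s * (norm x)\<^sup>2 \<le> x \<bullet> (S *v x)"
    using pos_def_lower_bound[OF assms] by blast
  define k where "k = 2 * norm (transpose A) / s"
  have "norm X \<le> (real CARD('n))\<^sup>2 * k" if X: "sym_mat X" and V: "pos_semidef V" and r: "ric A S V X = 0" for X V
  proof -
    have le: "norm (X *v x) \<le> k * norm x" for x
    proof (cases "X *v x = 0")
      case True
      then show ?thesis using s(1) by (simp add: k_def)
    next
      case False
      have "x \<bullet> ((X ** S ** X) *v x) = (X *v x) \<bullet> (S *v (X *v x))"
        using X by (simp only: matrix_vector_mul_assoc[symmetric] inner_matrix_vector[of x X] sym_matD)
      moreover have "x \<bullet> (ric A S V X *v x) = 0" by (simp add: r)
      ultimately have "2 * ((transpose A *v x) \<bullet> (X *v x)) + (X *v x) \<bullet> (S *v (X *v x)) + x \<bullet> (V *v x) = 0"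
        unfolding ric_def matrix_vector_mult_add_rdistrib inner_add_right lyap_quadratic_form[OF X] by simp
      then have "(X *v x) \<bullet> (S *v (X *v x)) \<le> - 2 * ((transpose A *v x) \<bullet> (X *v x))"
        using pos_semidef_nonneg[OF V, of x] by linarith
      also have "\<dots> \<le> 2 * (norm (transpose A *v x) * norm (X *v x))"
        using Cauchy_Schwarz_ineq2[of "transpose A *v x" "X *v x"] by linarith
      also have "\<dots> \<le> 2 * ((norm (transpose A) * norm x) * norm (X *v x))"
        by (intro mult_left_mono mult_right_mono norm_matrix_vector) auto
      finally have "s * (norm (X *v x))\<^sup>2 \<le> 2 * ((norm (transpose A) * norm x) * norm (X *v x))"
        using s(2)[of "X *v x"] by linarith
      then have "s * norm (X *v x) \<le> 2 * (norm (transpose A) * norm x)"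
        using False by (simp add: power2_eq_square mult.assoc[symmetric])
      then show ?thesis
        using s(1) by (simp add: k_def field_simps)
    qed
    have "\<bar>X $ i $ j\<bar> \<le> k" for i j
    proof -
      have "\<bar>X $ i $ j\<bar> \<le> norm (axis i (1::real)) * norm (X *v axis j 1)"
        unfolding matrix_entry by (rule Cauchy_Schwarz_ineq2)
      also have "\<dots> \<le> k"
        using le[of "axis j 1"] by simp
      finally show ?thesis .
    qed
    then have "(\<Sum>i\<in>UNIV. norm (X $ i)) \<le> (\<Sum>i\<in>(UNIV::'n set). \<Sum>j\<in>(UNIV::'n set). k)"
      by (intro sum_mono order_trans[OF norm_le_l1_cart])
    moreover have "norm X \<le> (\<Sum>i\<in>UNIV. norm (X $ i))"
      unfolding norm_vec_def[of X] by (intro L2_set_le_sum) auto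
    ultimately show ?thesis by (simp add: power2_eq_square mult.assoc)
  qed
  then show ?thesis using that by blast
qed

text \<open>Homotopy in the weight \<^term>\<open>\<theta>\<close> of the disturbance: strict feasibility is an open condition, and
  the gain bound, which excludes imaginary eigenvalues of the limit, makes it closed.\<close>

lemma (in transfer) bounded_real_strict:
  assumes W: "pos_def (Bw ** transpose Bw)" and b: "hinf < b"
  obtains X where "sym_mat X" "pos_def (- ric A S (inverse (b\<^sup>2) *\<^sub>R (Bw ** transpose Bw)) X)"
proof -
  define V where "V \<theta> = (\<theta> * inverse (b\<^sup>2)) *\<^sub>R (Bw ** transpose Bw)" for \<theta>
  have symS: "sym_mat S" using S by (rule pos_def_sym)
  have psdV: "pos_semidef (V \<theta>)" if "\<theta> \<ge> 0" for \<theta>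
    unfolding V_def using that W by (intro pos_semidef_scaleR pos_def_imp_pos_semidef) auto
  have symV: "sym_mat (V \<theta>)" for \<theta>
    unfolding V_def using W by (simp add: pos_def_sym)
  define F where "F = {\<theta>\<in>{0..1}. \<exists>X. sym_mat X \<and> pos_def (- ric A S (V \<theta>) X)}"
  have strict: "\<theta> \<in> F" if \<theta>: "\<theta> \<in> {0..1}" and st: "stab_ric A S (V \<theta>) X" for \<theta> X
  proof -
    obtain D where D: "pos_def D" "\<forall>\<^sub>F e in at_right 0. pos_def (- ric A S (V \<theta>) (X + e *\<^sub>R D))"
      using stab_ric_imp_strict[OF symS symV st] by blast
    then obtain e where "pos_def (- ric A S (V \<theta>) (X + e *\<^sub>R D))"
      using eventually_happens'[of "at_right (0::real)"] by auto
    moreover have "sym_mat (X + e *\<^sub>R D)"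
      using D(1) st by (simp add: pos_def_sym stab_ric_def)
    ultimately show ?thesis using \<theta> unfolding F_def by blast
  qed
  \<comment> \<open>Without disturbance the zero matrix is stabilizing, because \<open>A\<close> is
    Hurwitz.\<close>
  have "0 \<in> F"
    by (rule strict[of _ 0]) (simp_all add: stab_ric_def ric_def lyap_def V_def A)
  moreover have "openin (top_of_set {0..1}) F"
    unfolding openin_euclidean_subtopology_iff
  proof (intro conjI ballI)
    fix \<theta> assume "\<theta> \<in> F"
    then obtain X where X: "sym_mat X" "pos_def (- ric A S (V \<theta>) X)" unfolding F_def by blast
    have "((\<lambda>t. - ric A S (V t) X) \<longlongrightarrow> - ric A S (V \<theta>) X) (at \<theta>)"
      unfolding ric_def V_def by (intro tendsto_intros)
    then have "\<forall>\<^sub>F t in at \<theta>. pos_def (- ric A S (V t) X)"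
      using X by (intro pos_def_eventually[OF X(2)]) (simp_all add: symS symV)
    then obtain d where "d > 0" "\<And>t. t \<noteq> \<theta> \<Longrightarrow> dist t \<theta> < d \<Longrightarrow> pos_def (- ric A S (V t) X)"
      unfolding eventually_at by blast
    then have "\<forall>t\<in>{0..1}. dist t \<theta> < d \<longrightarrow> t \<in> F"
      using X unfolding F_def by (metis (mono_tags, lifting) mem_Collect_eq)
    then show "\<exists>e>0. \<forall>x'\<in>{0..1}. dist x' \<theta> < e \<longrightarrow> x' \<in> F"
      using \<open>d > 0\<close> by blast
  qed (auto simp: F_def)
  moreover have "closed F"
    unfolding closed_sequential_limits
  proof (intro allI impI)
    fix t \<theta> assume t: "(\<forall>k. t k \<in> F) \<and> t \<longlonglongrightarrow> \<theta>"
    have \<theta>: "\<theta> \<in> {0..1}"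
      using t closed_sequentially[of "{0..1::real}" t \<theta>] by (auto simp: F_def)
    have "\<exists>X. stab_ric A S (V (t k)) X" for k
    proof -
      obtain X0 where "sym_mat X0" "pos_def (- ric A S (V (t k)) X0)" using t unfolding F_def by blast
      then show ?thesis using stab_ric_exists[OF S symV] by blast
    qed
    then obtain X where X: "\<And>k. stab_ric A S (V (t k)) (X k)" by metis
    obtain c where c: "\<And>X V. sym_mat X \<Longrightarrow> pos_semidef V \<Longrightarrow> ric A S V X = 0 \<Longrightarrow> norm X \<le> c"
      using bounded_of_ric_nonpos[OF S] by blast
    have "X k \<in> cball 0 c" for k
      using X[of k] t psdV[of "t k"] by (auto simp: stab_ric_def F_def intro!: c)
    moreover have "compact (cball (0::real^'n^'n) c)" by simp
    ultimately obtain Y r where r: "strict_mono r" and Y: "(X \<circ> r) \<longlonglongrightarrow> Y"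
      unfolding compact_def by meson
    have tr: "(\<lambda>k. t (r k)) \<longlonglongrightarrow> \<theta>"
      using t LIMSEQ_subseq_LIMSEQ[OF _ r] by (auto simp: comp_def)
    have Y': "(\<lambda>k. X (r k)) \<longlonglongrightarrow> Y" using Y by (simp add: comp_def)
    have symY: "sym_mat Y"
      using closed_sequentially[OF closed_sym_mat _ Y'] X by (auto simp: stab_ric_def)
    have "(\<lambda>k. ric A S (V (t (r k))) (X (r k))) \<longlonglongrightarrow> ric A S (V \<theta>) Y"
      unfolding ric_def lyap_def V_def by (intro tendsto_intros Y' tr)
    then have ricY: "ric A S (V \<theta>) Y = 0"
      using X by (simp add: stab_ric_def LIMSEQ_const_iff)
    have lim: "(\<lambda>k. transpose (A + X (r k) ** S)) \<longlonglongrightarrow> transpose (A + Y ** S)"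
      by (intro tendsto_intros Y')
    have "hurwitz (transpose (A + Y ** S))"
      unfolding hurwitz_iff
    proof clarify
      fix y1 y2 \<alpha> \<omega>
      assume y: "transpose (A + Y ** S) *v y1 = \<alpha> *\<^sub>R y1 - \<omega> *\<^sub>R y2"
        "transpose (A + Y ** S) *v y2 = \<alpha> *\<^sub>R y2 + \<omega> *\<^sub>R y1" and "\<alpha> \<ge> (0::real)"
      show "y1 = 0 \<and> y2 = 0"
      proof (cases "\<alpha> = 0")
        case True
        then show ?thesis
          using no_imaginary_eigenvalue[OF W b _ symY, of \<theta> y1 \<omega> y2] \<theta> ricY y
          by (simp add: V_def del: transpose_matrix_vector)
      next
        case False
        show ?thesis
          by (rule hurwitz_limit[OF _ lim y]) (use X False \<open>\<alpha> \<ge> 0\<close> in \<open>auto simp: hurwitz_transpose stab_ric_def\<close>)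
      qed
    qed
    then have "stab_ric A S (V \<theta>) Y"
      using symY ricY by (simp add: stab_ric_def hurwitz_transpose)
    then show "\<theta> \<in> F" using strict \<theta> by blast
  qed
  then have "closedin (top_of_set {0..1}) F"
    by (rule closed_subset[rotated]) (auto simp: F_def)
  moreover have "connected {0..1::real}" by simp
  ultimately have "F = {0..1}"
    unfolding connected_clopen by blast
  then have "1 \<in> F" by simp
  then show ?thesis using that unfolding F_def V_def by auto
qed

section \<open>Perturbation of the stabilizing solution\<close>

lemma tendsto_ric:
  assumes "(a \<longlongrightarrow> A) F" "(s \<longlongrightarrow> S) F"
  shows "((\<lambda>t. ric (a t) (s t) V X) \<longlongrightarrow> ric A S V X) F"
  unfolding ric_def lyap_def using assms by (intro tendsto_intros)

lemma tendsto_lyap: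
  assumes "(a \<longlongrightarrow> A) F"
  shows "((\<lambda>t. lyap (a t) X) \<longlongrightarrow> lyap A X) F"
  unfolding lyap_def using assms by (intro tendsto_intros)

text \<open>Coefficients vary along a filter, later the neighbourhoods of a gain; \<open>V\<close>
  stays fixed because it does not depend on the gain.\<close>

locale ric_perturbation =
  fixes a s :: "'t \<Rightarrow> real^'n^'n" and F :: "'t filter" and A S V U :: "real^'n^'n"
  assumes a: "(a \<longlongrightarrow> A) F" and s: "(s \<longlongrightarrow> S) F" and pd: "\<And>t. pos_def (s t)"
    and S: "pos_def S" and V: "sym_mat V" and U: "stab_ric A S V U"
begin

lemma sym [simp]: "sym_mat (s t)" "sym_mat S" "sym_mat U" "sym_mat V"
  using pd S V U by (simp_all add: pos_def_sym stab_ric_def)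

lemma ric_U: "ric A S V U = 0" and hurwitz_U: "hurwitz (A + U ** S)"
  using U by (simp_all add: stab_ric_def)

text \<open>A strict solution for the limiting coefficients remains strict nearby, so it bounds the
  perturbed solution from above.\<close>

lemma eventually_upper:
  assumes "pos_def (- ric A S V X0)" "sym_mat X0"
  shows "\<forall>\<^sub>F t in F. \<exists>X. stab_ric (a t) (s t) V X \<and> pos_semidef (X0 - X)"
proof -
  have "((\<lambda>t. - ric (a t) (s t) V X0) \<longlongrightarrow> - ric A S V X0) F"
    by (intro tendsto_minus tendsto_ric a s)
  then have "\<forall>\<^sub>F t in F. pos_def (- ric (a t) (s t) V X0)"
    using assms by (intro pos_def_eventually[of "- ric A S V X0"]) simp_all
  then show ?thesis
    by eventually_elim (metis stab_ric_exists[OF pd V assms(2)])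
qed

lemma eventually_stab_ric: "\<forall>\<^sub>F t in F. \<exists>X. stab_ric (a t) (s t) V X"
proof -
  obtain D where D: "pos_def D" "\<forall>\<^sub>F e in at_right 0. pos_def (- ric A S V (U + e *\<^sub>R D))"
    using stab_ric_imp_strict[OF sym(2) sym(4) U] by blast
  then obtain e where "pos_def (- ric A S V (U + e *\<^sub>R D))"
    using eventually_happens'[of "at_right (0::real)"] by auto
  then have "\<forall>\<^sub>F t in F. \<exists>X. stab_ric (a t) (s t) V X \<and> pos_semidef (U + e *\<^sub>R D - X)"
    by (rule eventually_upper) (simp add: D(1) pos_def_sym)
  then show ?thesis by eventually_elim blast
qed

section \<open>First-order expansion of the perturbed solution\<close>

context
  fixes u :: "'t \<Rightarrow> real^'n^'n"
  assumes u: "\<forall>\<^sub>F t in F. stab_ric (a t) (s t) V (u t)"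
begin

lemma residual_expansion:
  "\<forall>\<^sub>F t in F. ric (a t) (s t) V U + lyap (a t + U ** s t) (u t - U) + (u t - U) ** s t ** (u t - U) = 0"
  using u
proof eventually_elim
  case (elim t)
  have "ric (a t) (s t) V (U + (u t - U)) = 0" using elim by (simp add: stab_ric_def)
  then show ?case by (simp only: ric_add[OF sym(1) sym(3)])
qed

lemma tendsto_solution: "(u \<longlongrightarrow> U) F"
proof (rule tendstoI)
  fix \<epsilon> :: real assume \<epsilon>: "\<epsilon> > 0"
  obtain D where D: "pos_def D" "lyap (A + U ** S) D = - mat 1"
    "\<forall>\<^sub>F e in at_right 0. pos_def (- ric A S V (U + e *\<^sub>R D))"
    using stab_ric_imp_strict[OF sym(2) sym(4) U] by blast
  have symD: "sym_mat D" using D(1) by (rule pos_def_sym)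
  \<comment> \<open>The constant of \<open>norm_le_of_sandwich\<close> for \<open>D\<close>; the
    bound is linear, so scaling \<open>D\<close> by \<open>e\<close> scales it by
    \<open>e\<close>.\<close>
  define c where "c = norm D + (real CARD('n))\<^sup>2 * (2 * trace D)"
  have "((\<lambda>e. e * c) \<longlongrightarrow> 0 * c) (at_right 0)"
    by (intro tendsto_intros)
  then have "\<forall>\<^sub>F e in at_right 0. e * c < \<epsilon>"
    using \<epsilon> by (intro order_tendstoD(2)) auto
  moreover have "\<forall>\<^sub>F e in at_right (0::real). e > 0"
    by (simp add: eventually_at_right_less)
  ultimately have "\<forall>\<^sub>F e in at_right 0. e > 0 \<and> e * c < \<epsilon> \<and> pos_def (- ric A S V (U + e *\<^sub>R D))"
    using D(3) by eventually_elim simp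
  then obtain e where e: "e > 0" "e * c < \<epsilon>" "pos_def (- ric A S V (U + e *\<^sub>R D))"
    using eventually_happens'[of "at_right (0::real)"] by auto
  have "\<forall>\<^sub>F t in F. \<exists>X. stab_ric (a t) (s t) V X \<and> pos_semidef (U + e *\<^sub>R D - X)"
    using e(3) symD by (intro eventually_upper) simp_all
  then have upper: "\<forall>\<^sub>F t in F. pos_semidef (e *\<^sub>R D - (u t - U))"
    using u
  proof eventually_elim
    case (elim t)
    then obtain X where X: "stab_ric (a t) (s t) V X" "pos_semidef (U + e *\<^sub>R D - X)" by blast
    have "X = u t" using stab_ric_unique[OF sym(1) X(1)] elim by blast
    then show ?case using X(2) by (simp add: algebra_simps)
  qed
  have lim: "((\<lambda>t. a t + U ** s t) \<longlongrightarrow> A + U ** S) F"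
    by (intro tendsto_intros a s)
  have "((\<lambda>t. - lyap (a t + U ** s t) D) \<longlongrightarrow> mat 1) F"
    using tendsto_minus[OF tendsto_lyap[OF lim, of D]] by (simp add: D(2))
  then have pd1: "\<forall>\<^sub>F t in F. pos_def (- lyap (a t + U ** s t) D)"
    using symD by (intro pos_def_eventually[OF pos_def_mat_1]) simp_all
  have "((\<lambda>t. ric (a t) (s t) V U - e *\<^sub>R lyap (a t + U ** s t) D) \<longlongrightarrow> e *\<^sub>R mat 1) F"
    using tendsto_diff[OF tendsto_ric[OF a s, of V U] tendsto_scaleR[OF tendsto_const tendsto_lyap[OF lim, of D], of e]]
    by (simp add: D(2) ric_U)
  then have pd2: "\<forall>\<^sub>F t in F. pos_def (ric (a t) (s t) V U - e *\<^sub>R lyap (a t + U ** s t) D)"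
    using symD e(1) by (intro pos_def_eventually[of "e *\<^sub>R mat 1"]) (simp_all add: pos_def_scaleR pos_def_mat_1)
  \<comment> \<open>Here the quadratic remainder has the favourable sign:
    \<open>e *\<^sub>R D + E\<close> has a strictly negative Lyapunov image, and \<open>D\<close>
    certifies that the perturbed matrix is Hurwitz.\<close>
  have lower: "\<forall>\<^sub>F t in F. pos_semidef (e *\<^sub>R D + (u t - U))"
    using u pd1 pd2 residual_expansion
  proof eventually_elim
    case (elim t)
    define M where "M = a t + U ** s t"
    define E where "E = u t - U"
    have symE: "sym_mat E" using elim(1) by (simp add: E_def stab_ric_def)
    have hM: "hurwitz M"
      using lyap_imp_hurwitz[OF pos_def_imp_pos_semidef[OF D(1)]] elim(2) by (simp add: M_def)
    have res: "ric (a t) (s t) V U + lyap M E + E ** s t ** E = 0"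
      using elim(4) by (simp add: M_def E_def)
    have "- lyap M (e *\<^sub>R D + E) = (ric (a t) (s t) V U - e *\<^sub>R lyap M D) + E ** s t ** E"
      using arg_cong[OF res, of "\<lambda>x. x - lyap M E"] by (simp add: lyap_add lyap_scaleR algebra_simps)
    moreover have "pos_def ((ric (a t) (s t) V U - e *\<^sub>R lyap M D) + E ** s t ** E)"
      using elim(3) symE pd by (intro pos_def_add_pos_semidef) (simp_all add: M_def pos_semidef_sandwich pos_def_imp_pos_semidef)
    ultimately have "pos_def (e *\<^sub>R D + E)"
      using lyap_inverse_pd[OF hM, of "e *\<^sub>R D + E"] symD symE by simp
    then show ?case by (simp add: E_def pos_def_imp_pos_semidef)
  qed
  show "\<forall>\<^sub>F t in F. dist (u t) U < \<epsilon>"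
    using upper lower
  proof eventually_elim
    case (elim t)
    have "norm (u t - U) \<le> norm (e *\<^sub>R D) + (real CARD('n))\<^sup>2 * (2 * trace (e *\<^sub>R D))"
      using elim by (rule norm_le_of_sandwich)
    also have "\<dots> = e * c"
      using e(1) by (simp add: c_def trace_scaleR algebra_simps)
    finally show ?case using e(2) by (simp add: dist_norm)
  qed
qed

definition N :: "'t \<Rightarrow> real^'n^'n" where "N t = (a t - A) + U ** (s t - S)"

text \<open>The error of linearising with the unperturbed matrix \<open>A + U ** S\<close>: its
  drift \<open>N t\<close> acting on the increment, plus the quadratic term. Both are of smaller
  order than the increment.\<close>

definition rem :: "'t \<Rightarrow> real^'n^'n" where
  "rem t = lyap (N t) (u t - U) + (u t - U) ** s t ** (u t - U)"

lemma tendsto_N: "(N \<longlongrightarrow> 0) F"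
proof -
  have "(N \<longlongrightarrow> (A - A) + U ** (S - S)) F"
    unfolding N_def by (intro tendsto_intros a s)
  then show ?thesis by simp
qed

lemma lyap_solution: "\<forall>\<^sub>F t in F. lyap (A + U ** S) (u t - U) = - (ric (a t) (s t) V U + rem t)"
  using residual_expansion
proof eventually_elim
  case (elim t)
  have "lyap (a t + U ** s t) (u t - U) = lyap (A + U ** S) (u t - U) + lyap (N t) (u t - U)"
    by (simp add: lyap_def N_def matrix_ring algebra_simps)
  then show ?case using elim by (simp add: rem_def add_eq_0_iff algebra_simps)
qed

lemma remainder_small:
  obtains \<eta> where "(\<eta> \<longlongrightarrow> 0) F" "\<And>t. norm (rem t) \<le> \<eta> t * norm (u t - U)"
proof -
  obtain c where c: "c > 0" "\<And>(X :: real^'n^'n) (Y :: real^'n^'n). norm (X ** Y) \<le> norm X * norm Y * c"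
    using bounded_bilinear.pos_bounded[OF bounded_bilinear_matrix_mul] by blast
  define \<eta> where "\<eta> t = norm (N t) * c + norm (transpose (N t)) * c + norm ((u t - U) ** s t) * c" for t
  have "(\<eta> \<longlongrightarrow> norm (0::real^'n^'n) * c + norm (transpose (0::real^'n^'n)) * c + norm ((U - U) ** S) * c) F"
    unfolding \<eta>_def by (intro tendsto_intros tendsto_N tendsto_solution s)
  then have "(\<eta> \<longlongrightarrow> 0) F" by simp
  moreover have "norm (rem t) \<le> \<eta> t * norm (u t - U)" for t
  proof -
    have "norm (rem t) \<le> norm (N t ** (u t - U)) + norm ((u t - U) ** transpose (N t)) + norm ((u t - U) ** s t ** (u t - U))"
      unfolding rem_def lyap_def by norm
    also have "\<dots> \<le> \<eta> t * norm (u t - U)"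
      using c(2)[of "N t" "u t - U"] c(2)[of "u t - U" "transpose (N t)"] c(2)[of "(u t - U) ** s t" "u t - U"]
      by (simp add: \<eta>_def algebra_simps)
    finally show ?thesis .
  qed
  ultimately show ?thesis using that by blast
qed

text \<open>An injective Lyapunov operator is bounded below by some \<open>m\<close>; once \<eta> is
  below m / 2 the remainder is absorbed into the left side.\<close>

lemma solution_lipschitz:
  obtains c where "c > 0" "\<forall>\<^sub>F t in F. norm (u t - U) \<le> c * norm (ric (a t) (s t) V U)"
proof -
  obtain \<eta> where \<eta>: "(\<eta> \<longlongrightarrow> 0) F" "\<And>t. norm (rem t) \<le> \<eta> t * norm (u t - U)"
    using remainder_small by blast
  have "inj (lyap (A + U ** S))"
    using linear_injective_0[OF linear_lyap] lyap_injective[OF hurwitz_U] by blast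
  then obtain m where m: "m > 0" "\<And>X. m * norm X \<le> norm (lyap (A + U ** S) X)"
    using linear_inj_bounded_below_pos[OF linear_lyap] by metis
  have "\<forall>\<^sub>F t in F. \<eta> t < m / 2"
    using \<eta>(1) m(1) by (intro order_tendstoD(2)) auto
  then have "\<forall>\<^sub>F t in F. norm (u t - U) \<le> (2 / m) * norm (ric (a t) (s t) V U)"
    using lyap_solution
  proof eventually_elim
    case (elim t)
    have "m * norm (u t - U) \<le> norm (ric (a t) (s t) V U + rem t)"
      using m(2)[of "u t - U"] unfolding elim(2) norm_minus_cancel .
    also have "\<dots> \<le> norm (ric (a t) (s t) V U) + \<eta> t * norm (u t - U)"
      using \<eta>(2)[of t] norm_triangle_ineq[of "ric (a t) (s t) V U" "rem t"] by linarith
    also have "\<eta> t * norm (u t - U) \<le> m / 2 * norm (u t - U)"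
      using elim(1) by (intro mult_right_mono) auto
    finally show ?case using m(1) by (simp add: field_simps)
  qed
  then show ?thesis using that[of "2 / m"] m(1) by simp
qed

lemma trace_lyap_adjoint:
  fixes X Y M :: "real^'n^'n"
  shows "trace (lyap (transpose M) Y ** X) = trace (Y ** lyap M X)"
proof -
  have "trace (transpose M ** Y ** X) = trace (Y ** X ** transpose M)"
    by (metis matrix_mul_assoc trace_mul_sym)
  then show ?thesis
    by (simp add: lyap_def matrix_ring trace_add add.commute)
qed

text \<open>The adjoint solution \<open>Y\<close> turns tr (S (u - U)) into tr (Y ric) plus a
  remainder, where ric is the residual of the fixed \<open>U\<close> under the perturbed
  coefficients. Thus no derivative of \<open>u\<close> enters.\<close>

lemma trace_expansion:
  assumes Y: "lyap (transpose (A + U ** S)) Y = - S"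
  obtains \<eta> where "(\<eta> \<longlongrightarrow> 0) F"
    "\<forall>\<^sub>F t in F. norm (trace (s t ** u t) - trace (S ** U)
        - (trace ((s t - S) ** U) + trace (Y ** ric (a t) (s t) V U))) \<le> \<eta> t * norm (ric (a t) (s t) V U)"
proof -
  obtain \<eta> where \<eta>: "(\<eta> \<longlongrightarrow> 0) F" "\<And>t. norm (rem t) \<le> \<eta> t * norm (u t - U)"
    using remainder_small by blast
  obtain c where c: "c > 0" "\<forall>\<^sub>F t in F. norm (u t - U) \<le> c * norm (ric (a t) (s t) V U)"
    using solution_lipschitz by blast
  obtain b where b: "b > 0" "\<And>(X :: real^'n^'n) (Y :: real^'n^'n). norm (X ** Y) \<le> norm X * norm Y * b"
    using bounded_bilinear.pos_bounded[OF bounded_bilinear_matrix_mul] by blast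
  obtain d where d: "d > 0" "\<And>X :: real^'n^'n. norm (trace X) \<le> norm X * d"
    using bounded_linear.pos_bounded[OF bounded_linear_trace] by blast
  define \<eta>' where "\<eta>' t = (norm (s t - S) * b * d + norm Y * b * d * \<bar>\<eta> t\<bar>) * c" for t
  have "(\<eta>' \<longlongrightarrow> (norm (S - S) * b * d + norm Y * b * d * \<bar>0\<bar>) * c) F"
    unfolding \<eta>'_def by (intro tendsto_intros s \<eta>(1))
  then have "(\<eta>' \<longlongrightarrow> 0) F" by simp
  moreover have "\<forall>\<^sub>F t in F. norm (trace (s t ** u t) - trace (S ** U)
        - (trace ((s t - S) ** U) + trace (Y ** ric (a t) (s t) V U))) \<le> \<eta>' t * norm (ric (a t) (s t) V U)"
    using c(2) lyap_solution
  proof eventually_elim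
    case (elim t)
    define D where "D = u t - U"
    have "trace (S ** D) = - trace (lyap (transpose (A + U ** S)) Y ** D)"
      by (simp add: Y matrix_minus_left trace_minus)
    also have "\<dots> = trace (Y ** ric (a t) (s t) V U) + trace (Y ** rem t)"
      unfolding trace_lyap_adjoint D_def elim(2) by (simp add: matrix_ring trace_minus trace_add trace_sub)
    finally have "trace (s t ** u t) - trace (S ** U) - (trace ((s t - S) ** U) + trace (Y ** ric (a t) (s t) V U))
        = trace ((s t - S) ** D) + trace (Y ** rem t)"
      by (simp add: D_def matrix_ring trace_sub)
    also have "norm \<dots> \<le> norm ((s t - S) ** D) * d + norm (Y ** rem t) * d"
      using d(2)[of "(s t - S) ** D"] d(2)[of "Y ** rem t"] by simp
    also have "\<dots> \<le> (norm (s t - S) * norm D * b) * d + (norm Y * (\<bar>\<eta> t\<bar> * norm D) * b) * d"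
    proof -
      have "norm (rem t) \<le> \<bar>\<eta> t\<bar> * norm D"
        using \<eta>(2)[of t] mult_right_mono[OF abs_ge_self, of "norm D" "\<eta> t"] by (simp add: D_def)
      then have "norm Y * norm (rem t) * b \<le> norm Y * (\<bar>\<eta> t\<bar> * norm D) * b"
        using b(1) by (intro mult_right_mono mult_left_mono) auto
      then have "norm (Y ** rem t) \<le> norm Y * (\<bar>\<eta> t\<bar> * norm D) * b"
        using b(2) order_trans by blast
      then show ?thesis
        using d(1) b(2)[of "s t - S" D] by (intro add_mono mult_right_mono) auto
    qed
    also have "\<dots> = (norm (s t - S) * b * d + norm Y * b * d * \<bar>\<eta> t\<bar>) * norm D"
      by (simp add: algebra_simps)
    also have "\<dots> \<le> (norm (s t - S) * b * d + norm Y * b * d * \<bar>\<eta> t\<bar>) * (c * norm (ric (a t) (s t) V U))"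
      using elim(1) b(1) d(1) by (intro mult_left_mono) (auto simp: D_def)
    finally show ?case by (simp add: \<eta>'_def mult.assoc)
  qed
  ultimately show ?thesis using that by blast
qed

end

end

section \<open>Duality between the two Riccati equations\<close>

lemma pos_def_injective: "pos_def M \<Longrightarrow> M *v x = 0 \<Longrightarrow> x = 0"
  unfolding pos_def_iff_pos_semidef by blast

lemma pos_def_inverse:
  fixes M :: "real^'n^'n"
  assumes "pos_def M"
  shows "M ** matrix_inv M = mat 1" "matrix_inv M ** M = mat 1" "pos_def (matrix_inv M)"
proof -
  have "det M \<noteq> 0"
    using assms unfolding det_eq_0_iff pos_def_iff_pos_semidef by blast
  then show inv: "M ** matrix_inv M = mat 1" "matrix_inv M ** M = mat 1"
    by (simp_all add: invertible_inv)
  have tM: "transpose M = M" using assms by (simp add: pos_def_sym sym_matD)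
  have "transpose (matrix_inv M) ** M = mat 1"
    using arg_cong[OF inv(1), of transpose] by (simp add: matrix_transpose_mul tM)
  then have sym: "transpose (matrix_inv M) = matrix_inv M"
    using inv(1) by (metis matrix_mul_assoc matrix_mul_lid matrix_mul_rid)
  have "x \<bullet> (matrix_inv M *v x) > 0" if "x \<noteq> 0" for x
  proof -
    define y where "y = matrix_inv M *v x"
    have x: "x = M *v y" by (simp add: y_def matrix_vector_mul_assoc inv)
    then have "y \<noteq> 0" using that by auto
    then have "y \<bullet> (M *v y) > 0" using assms by (rule pos_def_pos[rotated])
    then have "y \<bullet> x > 0" by (simp only: x[symmetric])
    then show ?thesis by (simp only: y_def inner_commute)
  qed
  then show "pos_def (matrix_inv M)"
    using sym by (simp add: pos_def_def sym_mat_def)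
qed

lemma matrix_inv_cancel:
  assumes "M ** M' = mat 1"
  shows "X ** M ** M' = X" "M ** (M' ** Z) = Z"
  using assms by (metis matrix_mul_assoc matrix_mul_rid, metis matrix_mul_assoc matrix_mul_lid)

text \<open>Congruence by the inverse transposes \<open>A\<close> and swaps the quadratic and the
  constant term.\<close>

lemma ric_inverse:
  assumes "N ** P = mat 1" "P ** N = mat 1"
  shows "ric (transpose A) V S P = P ** ric A S V N ** P"
proof -
  have "P ** ric A S V N ** P = P ** A ** (N ** P) + (P ** N) ** transpose A ** P
      + (P ** N) ** S ** (N ** P) + P ** V ** P"
    unfolding ric_def lyap_def by (simp only: matrix_add_ldistrib matrix_add_left matrix_mul_assoc)
  then show ?thesis
    by (simp add: assms ric_def lyap_def add_ac)
qed

text \<open>The equation of \<open>N\<close> itself says that \<open>N\<close> intertwines the dual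
  closed loop with \<open>- (A + N ** S)\<close>.\<close>

lemma stab_ric_of_antistab:
  assumes N: "pos_def N" "ric A S V N = 0" "hurwitz (- (A + N ** S))"
  shows "stab_ric (transpose A) V S (matrix_inv N)"
proof -
  let ?P = "matrix_inv N"
  note inv = pos_def_inverse[OF N(1)]
  have "N ** (transpose A + ?P ** V) = N ** transpose A + V"
    by (simp add: matrix_ring inv)
  also have "\<dots> = (- (A + N ** S)) ** N"
    using N(2) by (simp add: ric_def lyap_def matrix_ring eq_neg_iff_add_eq_0 algebra_simps)
  finally have "hurwitz (transpose A + ?P ** V)"
    by (rule hurwitz_similar[OF N(3)]) (rule pos_def_injective[OF N(1)])
  then show ?thesis
    using inv N(2) by (simp add: stab_ric_def ric_inverse[OF inv(1,2)] pos_def_sym)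
qed

text \<open>For Z = Y^-1 the Lyapunov equation becomes lyap M Z = -ZSZ, which cancels the quadratic
  term of the expansion at U; so U + Z is a second solution. \<open>Y\<close> intertwines its
  negated closed loop with the transpose of the stable one, hence it is antistabilizing.\<close>

lemma stab_ric_dual:
  fixes A S V :: "real^'n^'n"
  assumes U: "stab_ric A S V U" "pos_semidef U" and Y: "pos_def Y" "lyap (transpose (A + U ** S)) Y = - S"
    and S: "sym_mat S"
  shows "pos_def (matrix_inv Y + U)" "stab_ric (transpose A) V S (matrix_inv (matrix_inv Y + U))"
proof -
  let ?Z = "matrix_inv Y"
  note inv = pos_def_inverse[OF Y(1)]
  have Z: "transpose ?Z = ?Z" using inv(3) by (simp add: pos_def_sym sym_matD)
  show pd: "pos_def (?Z + U)"
    using inv(3) U(2) by (rule pos_def_add_pos_semidef)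
  define M where "M = A + U ** S"
  have YM: "transpose M ** Y + Y ** M = - S"
    using Y(2) by (simp add: lyap_def M_def)
  have "lyap M ?Z = ?Z ** (transpose M ** Y + Y ** M) ** ?Z"
    by (simp add: lyap_def matrix_ring inv matrix_inv_cancel[OF inv(1)] add.commute)
  then have "lyap M ?Z = - (?Z ** S ** ?Z)"
    by (simp add: YM matrix_ring)
  moreover have "ric A S V (U + ?Z) = ric A S V U + lyap M ?Z + ?Z ** S ** ?Z"
    unfolding M_def using S U(1) by (intro ric_add) (simp_all add: stab_ric_def)
  ultimately have "ric A S V (?Z + U) = 0"
    using U(1) by (simp add: stab_ric_def add.commute)
  moreover have "hurwitz (- (A + (?Z + U) ** S))"
  proof -
    have "Y ** (- (A + (?Z + U) ** S)) = - (Y ** M) - S"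
      by (simp add: M_def matrix_ring inv)
    also have "- (Y ** M) - S = - (Y ** M) + - S" by simp
    also have "\<dots> = transpose M ** Y"
      by (simp add: YM[symmetric])
    finally show ?thesis
      by (rule hurwitz_similar[rotated]) (use U(1) pos_def_injective[OF Y(1)] in \<open>simp_all add: M_def hurwitz_transpose stab_ric_def\<close>)
  qed
  ultimately show "stab_ric (transpose A) V S (matrix_inv (?Z + U))"
    using pd by (intro stab_ric_of_antistab)
qed

section \<open>Gradients of trace functionals\<close>

lemma trace_transpose: "trace (transpose M) = trace M"
  by (simp add: trace_def transpose_def)

lemma trace_pairing_eq_0:
  fixes G :: "real^'n^'m"
  assumes "\<And>E. trace (G ** E) = 0"
  shows "G = 0"
proof -
  have "(\<Sum>i\<in>UNIV. \<Sum>j\<in>UNIV. G $ i $ j * G $ i $ j) = trace (G ** transpose G)"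
    by (simp add: trace_def matrix_matrix_mult_def transpose_def)
  then have "(\<Sum>i\<in>UNIV. \<Sum>j\<in>UNIV. G $ i $ j * G $ i $ j) = 0" using assms by simp
  then show ?thesis
    by (simp add: sum_nonneg_eq_0_iff sum_nonneg vec_eq_iff)
qed

lemma has_derivative_of_small_difference:
  fixes f g :: "'a::real_normed_vector \<Rightarrow> real"
  assumes f: "(f has_derivative f') (at x)"
    and \<eta>: "(\<eta> \<longlongrightarrow> 0) (at x)"
    and le: "\<forall>\<^sub>F y in at x. norm ((g y - g x) - (f y - f x)) \<le> \<eta> y * norm (y - x)"
  shows "(g has_derivative f') (at x)"
proof -
  obtain d where d: "d > 0" "\<And>y. y \<noteq> x \<Longrightarrow> dist y x < d \<Longrightarrow> norm ((g y - g x) - (f y - f x)) \<le> \<eta> y * norm (y - x)"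
    using le unfolding eventually_at by blast
  have "((\<lambda>y. g y - f y) has_derivative (\<lambda>_. 0)) (at x)"
  proof (rule has_derivativeI_sandwich[OF d(1) _ _ \<eta>])
    fix y assume y: "y \<noteq> x" "dist y x < d"
    have "norm (g y - f y - (g x - f x) - 0) = norm ((g y - g x) - (f y - f x))"
      by (simp add: algebra_simps)
    then show "norm (g y - f y - (g x - f x) - 0) / norm (y - x) \<le> \<eta> y"
      using d(2)[OF y] y(1) by (simp add: divide_le_eq)
  qed simp
  from has_derivative_add[OF f this] show ?thesis by simp
qed

text \<open>Converts errors measured by a residual that vanishes at \<open>x\<close> into errors
  measured by the distance to \<open>x\<close>.\<close>

lemma has_derivative_bounded_quotient:
  fixes f :: "'a::real_normed_vector \<Rightarrow> 'b::real_normed_vector"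
  assumes f: "(f has_derivative f') (at x)" and "f x = 0"
  obtains c where "c > 0" "\<forall>\<^sub>F y in at x. norm (f y) \<le> c * norm (y - x)"
proof -
  obtain b where b: "b > 0" "\<And>h. norm (f' h) \<le> norm h * b"
    using bounded_linear.pos_bounded[OF has_derivative_bounded_linear[OF f]] by blast
  have "((\<lambda>y. norm (f y - f x - f' (y - x)) / norm (y - x)) \<longlongrightarrow> 0) (at x)"
    using f by (simp add: has_derivative_iff_norm)
  then have "\<forall>\<^sub>F y in at x. norm (f y - f x - f' (y - x)) / norm (y - x) < 1"
    by (intro order_tendstoD(2)) auto
  moreover have "\<forall>\<^sub>F y in at x. y \<noteq> x"
    by (simp add: eventually_at_filter)
  ultimately have "\<forall>\<^sub>F y in at x. norm (f y) \<le> (b + 1) * norm (y - x)"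
  proof eventually_elim
    case (elim y)
    have "norm (f y) \<le> norm (f y - f' (y - x)) + norm (f' (y - x))" by norm
    also have "\<dots> \<le> norm (y - x) + norm (y - x) * b"
      using elim b(2)[of "y - x"] assms(2) by (simp add: divide_less_eq)
    finally show ?case by (simp add: algebra_simps)
  qed
  then show ?thesis using that[of "b + 1"] b(1) by simp
qed

lemmas has_derivative_matrix_mul = bounded_bilinear.FDERIV[OF bounded_bilinear_matrix_mul]
lemmas has_derivative_matrix_mul_const =
  bounded_linear.has_derivative[OF bounded_bilinear.bounded_linear_left[OF bounded_bilinear_matrix_mul]]
lemmas has_derivative_const_matrix_mul =
  bounded_linear.has_derivative[OF bounded_bilinear.bounded_linear_right[OF bounded_bilinear_matrix_mul]]
lemmas has_derivative_transpose = bounded_linear.has_derivative[OF bounded_linear_transpose]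
lemmas has_derivative_trace = bounded_linear.has_derivative[OF bounded_linear_trace]

section \<open>The mixed problem\<close>

locale mixed =
  fixes A Q Bw :: "real^'n^'n" and B :: "real^'m^'n" and R :: "real^'m^'m" and \<beta> :: real
  assumes Q: "pos_def Q" and R: "pos_def R" and \<beta>: "\<beta> > 0" and W: "pos_def (Bw ** transpose Bw)"
begin

abbreviation "AK K \<equiv> closed_loop A B K"
abbreviation "SK K \<equiv> S_mat Q R K"

text \<open>The solutions of the paper are rescaled: \<^term>\<open>stab_ric (AK K) (SK K) V U\<close> holds for
  \<open>U = \<beta>\<^sup>-\<^sup>2 X\<^sub>K\<close>, while \<open>M\<close> is the quadratic term of the game Riccati equation.\<close>

definition V where "V = inverse (\<beta>\<^sup>2) *\<^sub>R (Bw ** transpose Bw)"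
definition Ri where "Ri = matrix_inv R"
definition M where "M = V - B ** Ri ** transpose B"

lemma V: "pos_def V"
  using W \<beta> by (simp add: V_def pos_def_scaleR)

lemma Ri: "R ** Ri = mat 1" "Ri ** R = mat 1" "transpose Ri = Ri"
  using pos_def_inverse[OF R] by (simp_all add: Ri_def pos_def_sym sym_matD)

lemma tR: "transpose R = R" and tV: "transpose V = V"
  using R V by (simp_all add: pos_def_sym sym_matD)

lemma S: "pos_def (SK K)"
  unfolding S_mat_def using Q R by (intro pos_def_add_pos_semidef pos_semidef_congruence pos_def_imp_pos_semidef)

lemma symM: "sym_mat M"
  by (simp add: M_def sym_mat_def matrix_ring tV Ri)

lemma sym [simp]: "sym_mat V" "sym_mat (SK K)" "sym_mat M"
  using V S symM by (simp_all add: pos_def_sym)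

text \<open>Definiteness of \<open>V\<close> passes to \<open>U\<close>, which makes
  \<open>U\<close> a cancellable factor of the gradient.\<close>

lemma stab_ric_pos_def:
  assumes "hurwitz (AK K)" "stab_ric (AK K) (SK K) V U"
  shows "pos_def U"
proof (rule lyap_inverse_pd[OF assms(1)])
  show symU: "sym_mat U" using assms(2) by (simp add: stab_ric_def)
  have "lyap (AK K) U + (U ** SK K ** U + V) = 0"
    using assms(2) by (simp add: stab_ric_def ric_def add.assoc)
  then have "- lyap (AK K) U = V + U ** SK K ** U"
    by (simp add: minus_unique add.commute)
  then show "pos_def (- lyap (AK K) U)"
    using V symU S[of K] by (simp add: pos_def_add_pos_semidef pos_semidef_sandwich pos_def_imp_pos_semidef)
qed

lemma X_sol_eq:
  assumes h: "hurwitz (AK K)" and U: "stab_ric (AK K) (SK K) V U"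
  shows "X_sol A B Bw Q R \<beta> K = \<beta>\<^sup>2 *\<^sub>R U"
  unfolding X_sol_def
proof (rule the_equality)
  have eq: "AK K ** (\<beta>\<^sup>2 *\<^sub>R X) + (\<beta>\<^sup>2 *\<^sub>R X) ** transpose (AK K)
      + inverse (\<beta>\<^sup>2) *\<^sub>R ((\<beta>\<^sup>2 *\<^sub>R X) ** SK K ** (\<beta>\<^sup>2 *\<^sub>R X)) + Bw ** transpose Bw
      = \<beta>\<^sup>2 *\<^sub>R ric (AK K) (SK K) V X" for X
  proof -
    have "inverse (\<beta>\<^sup>2) * (\<beta>\<^sup>2 * \<beta>\<^sup>2) = \<beta>\<^sup>2" "\<beta>\<^sup>2 * inverse (\<beta>\<^sup>2) = 1"
      using \<beta> by (simp_all only: mult.assoc[symmetric]) simp_all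
    then show ?thesis
      by (simp only: ric_def lyap_def matrix_ring V_def scaleR_right_distrib scaleR_scaleR scaleR_one mult.assoc)
  qed
  have stab: "inverse (\<beta>\<^sup>2) *\<^sub>R ((\<beta>\<^sup>2 *\<^sub>R X) ** SK K) = X ** SK K" for X
    using \<beta> by (simp add: matrix_ring)
  show "pos_semidef (\<beta>\<^sup>2 *\<^sub>R U) \<and>
    AK K ** (\<beta>\<^sup>2 *\<^sub>R U) + (\<beta>\<^sup>2 *\<^sub>R U) ** transpose (AK K)
      + inverse (\<beta>\<^sup>2) *\<^sub>R ((\<beta>\<^sup>2 *\<^sub>R U) ** SK K ** (\<beta>\<^sup>2 *\<^sub>R U)) + Bw ** transpose Bw = 0 \<and>
    hurwitz (AK K + inverse (\<beta>\<^sup>2) *\<^sub>R ((\<beta>\<^sup>2 *\<^sub>R U) ** SK K))"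
    unfolding eq stab using U stab_ric_pos_def[OF h U]
    by (simp add: stab_ric_def pos_semidef_scaleR pos_def_imp_pos_semidef)
  fix X :: "real^'n^'n"
  define X' where "X' = inverse (\<beta>\<^sup>2) *\<^sub>R X"
  have X: "X = \<beta>\<^sup>2 *\<^sub>R X'" using \<beta> by (simp add: X'_def)
  assume "pos_semidef X \<and>
    AK K ** X + X ** transpose (AK K) + inverse (\<beta>\<^sup>2) *\<^sub>R (X ** SK K ** X) + Bw ** transpose Bw = 0 \<and>
    hurwitz (AK K + inverse (\<beta>\<^sup>2) *\<^sub>R (X ** SK K))"
  then have *: "pos_semidef X" "\<beta>\<^sup>2 *\<^sub>R ric (AK K) (SK K) V X' = 0" "hurwitz (AK K + X' ** SK K)"
    unfolding X eq stab by blast+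
  have "sym_mat X'" unfolding X'_def using *(1) by (simp add: pos_semidef_sym)
  then have "stab_ric (AK K) (SK K) V X'"
    using * \<beta> by (simp add: stab_ric_def)
  then have "X' = U" using stab_ric_unique[OF sym(2) _ U] by blast
  then show "X = \<beta>\<^sup>2 *\<^sub>R U" using X by simp
qed

lemma J_mix_eq:
  assumes "hurwitz (AK K)" "stab_ric (AK K) (SK K) V U"
  shows "J_mix A B Bw Q R \<beta> K = \<beta>\<^sup>2 * trace (SK K ** U)"
  using X_sol_eq[OF assms] by (simp add: J_mix_def matrix_ring trace_scaleR)

section \<open>Gain bounds and feasibility\<close>

definition Cmat :: "real^'n^'m \<Rightarrow> real^'n^('n + 'm)" where
  "Cmat K = (\<chi> i. case i of Inl j \<Rightarrow> mat_sqrt Q $ j | Inr j \<Rightarrow> (mat_sqrt R ** K) $ j)"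

lemma Cmat_inner: "(Cmat K *v x) \<bullet> (Cmat K *v y) = x \<bullet> (SK K *v y)"
proof -
  have l: "(Cmat K *v x) $ Inl j = (mat_sqrt Q *v x) $ j" for x j
    by (simp add: Cmat_def matrix_vector_mult_def)
  have r: "(Cmat K *v x) $ Inr j = ((mat_sqrt R ** K) *v x) $ j" for x j
    by (simp add: Cmat_def matrix_vector_mult_def)
  have tq: "transpose (mat_sqrt Q) = mat_sqrt Q" and tr: "transpose (mat_sqrt R) = mat_sqrt R"
    using mat_sqrt(1)[OF Q] mat_sqrt(1)[OF R] by (simp_all add: pos_semidef_def sym_mat_def)
  have plus: "(\<Sum>i\<in>UNIV. g i) = (\<Sum>j\<in>UNIV. g (Inl j)) + (\<Sum>j\<in>UNIV. g (Inr j))" for g :: "'n + 'm \<Rightarrow> real"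
    using sum.Plus[of "UNIV :: 'n set" "UNIV :: 'm set" g] by simp
  have "(Cmat K *v x) \<bullet> (Cmat K *v y)
      = (mat_sqrt Q *v x) \<bullet> (mat_sqrt Q *v y) + ((mat_sqrt R ** K) *v x) \<bullet> ((mat_sqrt R ** K) *v y)"
    unfolding inner_vec_def plus by (simp add: l r)
  also have "(mat_sqrt Q *v x) \<bullet> (mat_sqrt Q *v y) = x \<bullet> (Q *v y)"
    by (simp only: inner_matrix_vector_left tq matrix_vector_mul_assoc mat_sqrt(2)[OF Q])
  also have "((mat_sqrt R ** K) *v x) \<bullet> ((mat_sqrt R ** K) *v y) = x \<bullet> ((transpose K ** (mat_sqrt R ** mat_sqrt R) ** K) *v y)"
    by (simp only: inner_matrix_vector_left matrix_transpose_mul tr matrix_vector_mul_assoc matrix_mul_assoc)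
  finally show ?thesis
    by (simp only: mat_sqrt(2)[OF R] S_mat_def matrix_vector_mult_add_rdistrib inner_add_right)
qed

lemma transfer_closed_loop: "hurwitz (AK K) \<Longrightarrow> transfer (AK K) (SK K) (Cmat K)"
  by unfold_locales (simp_all add: S Cmat_inner)

lemma hinf_norm_eq: "hurwitz (AK K) \<Longrightarrow> hinf_norm A B Bw Q R K = transfer.hinf (AK K) Bw (Cmat K)"
  unfolding hinf_norm_def transfer.hinf_def[OF transfer_closed_loop] T_inf_def
    transfer.T_def[OF transfer_closed_loop] by (simp add: Cmat_def Let_def)

lemma K_beta_strict:
  assumes "K \<in> K_beta A B Bw Q R \<beta>"
  obtains X where "pos_def X" "pos_def (- ric (AK K) (SK K) V X)"
proof -
  have h: "hurwitz (AK K)" and n: "hinf_norm A B Bw Q R K < \<beta>"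
    using assms by (simp_all add: K_beta_def stab_set_def)
  obtain X where X: "sym_mat X" "pos_def (- ric (AK K) (SK K) V X)"
    using transfer.bounded_real_strict[OF transfer_closed_loop[OF h] W, of \<beta>] n
    unfolding hinf_norm_eq[OF h] V_def by blast
  have "- lyap (AK K) X = - ric (AK K) (SK K) V X + (V + X ** SK K ** X)"
    by (simp add: ric_def)
  moreover have "pos_def (- ric (AK K) (SK K) V X + (V + X ** SK K ** X))"
    using X V S[of K] by (intro pos_def_add_pos_semidef pos_semidef_add)
      (simp_all add: pos_semidef_sandwich pos_def_imp_pos_semidef)
  ultimately have "pos_def X"
    using lyap_inverse_pd[OF h X(1)] by simp
  then show ?thesis using that X(2) by blast
qed

text \<open>Completing the square in the gain: the square vanishes precisely at the gain of the
  theorem, as \<open>R\<close> is definite.\<close>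

lemma ric_feedback:
  assumes "sym_mat P"
  shows "ric (transpose (AK K)) V (SK K) P = ric (transpose A) M Q P
    + transpose (K + Ri ** transpose B ** P) ** R ** (K + Ri ** transpose B ** P)"
  using assms
  by (simp add: ric_def lyap_def closed_loop_def S_mat_def M_def sym_mat_def matrix_ring Ri matrix_inv_cancel[OF Ri(2)]
      matrix_inv_cancel[OF Ri(1)] algebra_simps)

lemma stab_ric_feedback:
  assumes "K = - (Ri ** transpose B ** P)"
  shows "stab_ric (transpose (AK K)) V (SK K) P \<longleftrightarrow> stab_ric (transpose A) M Q P"
proof (cases "sym_mat P")
  case True
  have "transpose (AK K) + P ** V = transpose A + P ** M"
    using True by (simp add: assms closed_loop_def M_def sym_mat_def matrix_ring Ri)
  then show ?thesis
    using ric_feedback[OF True, of K] by (simp add: stab_ric_def assms)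
qed (simp add: stab_ric_def)

text \<open>The strict solution of some feasible gain is strict for the inverse equation too. Its
  antistabilizing solution \<open>N\<close> lies above the definite \<open>X\<close>, hence is
  invertible, and P = N^-1.\<close>

lemma ARE_solution_exists:
  assumes "K \<in> K_beta A B Bw Q R \<beta>"
  obtains P where "pos_def P" "stab_ric (transpose A) M Q P"
proof -
  obtain X where X: "pos_def X" "pos_def (- ric (AK K) (SK K) V X)"
    using K_beta_strict[OF assms] by blast
  have symX: "transpose X = X" using X(1) by (simp add: pos_def_sym sym_matD)
  \<comment> \<open>The completed-square factor K + R^-1 B^T X^-1, multiplied by X on the
    right.\<close>
  define L where "L = K ** X + Ri ** transpose B"
  have "ric (AK K) (SK K) V X = ric A Q M X + transpose L ** R ** L"
    by (simp add: L_def ric_def lyap_def closed_loop_def S_mat_def M_def matrix_ring symX Ri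
        matrix_inv_cancel[OF Ri(2)] matrix_inv_cancel[OF Ri(1)] algebra_simps)
  then have "- ric A Q M X = - ric (AK K) (SK K) V X + transpose L ** R ** L"
    by simp
  moreover have "pos_def (- ric (AK K) (SK K) V X + transpose L ** R ** L)"
    using X(2) R by (intro pos_def_add_pos_semidef pos_semidef_congruence pos_def_imp_pos_semidef)
  ultimately have "pos_def (- ric A Q M X)" by simp
  then obtain N where N: "sym_mat N" "ric A Q M N = 0" "hurwitz (- (A + N ** Q))" "pos_semidef (N - X)"
    using antistab_ric_exists[OF Q symM pos_def_sym[OF X(1)]] by blast
  have "pos_def N"
    using pos_def_add_pos_semidef[OF X(1) N(4)] by simp
  then show ?thesis
    using that pos_def_inverse(3) stab_ric_of_antistab N(2,3) by blast
qed

text \<open>Semidefinite \<open>P\<close> is a Lyapunov certificate for the closed loop. Since the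
  norm bound must be strict, \<open>P\<close> is first moved along \<open>D\<close> to a strict
  solution.\<close>

lemma K_beta_memI:
  assumes "pos_semidef P" and P: "stab_ric (transpose (AK K)) V (SK K) P"
  shows "K \<in> K_beta A B Bw Q R \<beta>"
proof -
  have symP: "sym_mat P" using P by (simp add: stab_ric_def)
  have "lyap (transpose (AK K)) P + (P ** V ** P + SK K) = 0"
    using P by (simp add: stab_ric_def ric_def add.assoc)
  then have "- lyap (transpose (AK K)) P = SK K + P ** V ** P"
    by (simp add: minus_unique add.commute)
  moreover have "pos_def (SK K + P ** V ** P)"
    using V S[of K] symP by (simp add: pos_def_add_pos_semidef pos_semidef_sandwich pos_def_imp_pos_semidef)
  ultimately have h: "hurwitz (AK K)"
    using lyap_imp_hurwitz[OF assms(1), of "transpose (AK K)"] by (simp add: hurwitz_transpose)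
  obtain D where D: "pos_def D" "\<forall>\<^sub>F e in at_right 0. pos_def (- ric (transpose (AK K)) V (SK K) (P + e *\<^sub>R D))"
    using stab_ric_imp_strict[OF sym(1) sym(2) P] by blast
  then obtain e where e: "pos_def (- ric (transpose (AK K)) V (SK K) (P + e *\<^sub>R D))"
    using eventually_happens'[of "at_right (0::real)"] by auto
  define P' where "P' = P + e *\<^sub>R D"
  have "sym_mat P'" using symP D(1) by (simp add: P'_def pos_def_sym)
  moreover have "ric (transpose (AK K)) V (SK K) P'
      = lyap (transpose (AK K)) P' + SK K + inverse (\<beta>\<^sup>2) *\<^sub>R (P' ** (Bw ** transpose Bw) ** P')"
    by (simp add: ric_def V_def matrix_ring)
  ultimately have "transfer.hinf (AK K) Bw (Cmat K) < \<beta>"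
    using transfer.hinf_less[OF transfer_closed_loop[OF h] _ \<beta>, of P'] e by (simp add: P'_def)
  then show ?thesis
    using h by (simp add: K_beta_def stab_set_def hinf_norm_eq)
qed

section \<open>Derivative of the mixed cost\<close>

lemma closed_loop_has_derivative: "(closed_loop A B has_derivative (\<lambda>E. B ** E)) (at K)"
proof -
  have "bounded_linear ((**) B :: real^'n^'m \<Rightarrow> real^'n^'n)"
    by (rule bounded_bilinear.bounded_linear_right[OF bounded_bilinear_matrix_mul])
  from has_derivative_add[OF has_derivative_const bounded_linear_imp_has_derivative[OF this]]
  show ?thesis unfolding closed_loop_def[abs_def] by simp
qed

lemma S_mat_has_derivative:
  "(S_mat Q R has_derivative (\<lambda>E. transpose E ** R ** K + transpose K ** R ** E)) (at K)"
proof -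
  have "((\<lambda>K. transpose K ** R) has_derivative (\<lambda>E. transpose E ** R)) (at K)"
    by (intro has_derivative_matrix_mul_const has_derivative_transpose has_derivative_ident)
  from has_derivative_matrix_mul[OF this has_derivative_ident]
  have "((\<lambda>K. transpose K ** R ** K) has_derivative (\<lambda>E. transpose E ** R ** K + transpose K ** R ** E)) (at K)"
    by (simp add: add.commute)
  from has_derivative_add[OF has_derivative_const this] show ?thesis
    unfolding S_mat_def[abs_def] by simp
qed

lemma J_mix_has_derivative:
  fixes K :: "real^'n^'m"
  assumes h: "hurwitz (AK K)" and U: "stab_ric (AK K) (SK K) V U"
    and Y: "sym_mat Y" "lyap (transpose (AK K + U ** SK K)) Y = - SK K"
  shows "(J_mix A B Bw Q R \<beta> has_derivative
     (\<lambda>E. 2 * \<beta>\<^sup>2 * trace (U ** (transpose K ** R + Y ** U ** transpose K ** R + Y ** B) ** E))) (at K)"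
proof -
  have tA: "(AK \<longlongrightarrow> AK K) (at K)"
    using has_derivative_continuous[OF closed_loop_has_derivative] by (simp add: continuous_at)
  have tS: "(SK \<longlongrightarrow> SK K) (at K)"
    using has_derivative_continuous[OF S_mat_has_derivative] by (simp add: continuous_at)
  interpret P: ric_perturbation AK SK "at K" "AK K" "SK K" V U
    by unfold_locales (simp_all add: tA tS S U)
  \<comment> \<open>One Lyapunov matrix certifies all nearby gains, as \<open>J_mix_eq\<close>
    requires stability there.\<close>
  obtain Z where Z: "pos_def Z" "pos_def (- lyap (AK K) Z)"
    using hurwitz_imp_lyap[OF h] by blast
  have "\<forall>\<^sub>F K' in at K. pos_def (- lyap (AK K') Z)"
    using Z by (intro pos_def_eventually[OF Z(2)] tendsto_minus tendsto_lyap tA) (simp add: pos_def_sym)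
  then have hur: "\<forall>\<^sub>F K' in at K. hurwitz (AK K')"
    by eventually_elim (rule lyap_imp_hurwitz[OF pos_def_imp_pos_semidef[OF Z(1)]])
  \<comment> \<open>Arbitrary where no solution exists; only the values near \<open>K\<close>
    enter.\<close>
  define u where "u K' = (SOME X. stab_ric (AK K') (SK K') V X)" for K'
  have u: "\<forall>\<^sub>F K' in at K. stab_ric (AK K') (SK K') V (u K')"
    using P.eventually_stab_ric unfolding u_def by eventually_elim (rule someI_ex)
  define \<Phi> where "\<Phi> K' = ric (AK K') (SK K') V U" for K'
  define d\<Phi> where "d\<Phi> E = lyap (B ** E) U + U ** (transpose E ** R ** K + transpose K ** R ** E) ** U" for E
  have \<Phi>: "(\<Phi> has_derivative d\<Phi>) (at K)"
  proof -
    have "((\<lambda>K'. AK K' ** U + U ** transpose (AK K') + U ** SK K' ** U + V) has_derivative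
        (\<lambda>E. B ** E ** U + U ** transpose (B ** E)
          + U ** (transpose E ** R ** K + transpose K ** R ** E) ** U + 0)) (at K)"
      by (intro has_derivative_add has_derivative_const has_derivative_matrix_mul_const has_derivative_const_matrix_mul
          has_derivative_transpose closed_loop_has_derivative S_mat_has_derivative)
    then show ?thesis
      by (simp add: \<Phi>_def[abs_def] d\<Phi>_def[abs_def] ric_def lyap_def)
  qed
  have \<Phi>0: "\<Phi> K = 0" using U by (simp add: \<Phi>_def stab_ric_def)
  \<comment> \<open>An explicit comparison function: the solution is frozen at \<open>U\<close>, and
    its variation is represented through \<open>Y\<close> and the residual \<Phi>.\<close>
  define f where "f K' = \<beta>\<^sup>2 * (trace (SK K' ** U) + trace (Y ** \<Phi> K'))" for K'
  have "(f has_derivative (\<lambda>E. \<beta>\<^sup>2 * (trace ((transpose E ** R ** K + transpose K ** R ** E) ** U)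
      + trace (Y ** d\<Phi> E)))) (at K)"
    unfolding f_def[abs_def]
    by (intro has_derivative_add has_derivative_mult_right has_derivative_matrix_mul_const
        has_derivative_const_matrix_mul has_derivative_trace \<Phi> S_mat_has_derivative)
  moreover have "\<beta>\<^sup>2 * (trace ((transpose E ** R ** K + transpose K ** R ** E) ** U) + trace (Y ** d\<Phi> E))
      = 2 * \<beta>\<^sup>2 * trace (U ** (transpose K ** R + Y ** U ** transpose K ** R + Y ** B) ** E)" for E
  proof -
    have tU: "transpose U = U" and tY: "transpose Y = Y"
      using U Y by (simp_all add: stab_ric_def sym_mat_def)
    have 1: "trace (transpose E ** R ** K ** U) = trace (U ** transpose K ** R ** E)"
      using trace_transpose[of "U ** transpose K ** R ** E"]
      by (simp add: matrix_transpose_mul matrix_mul_assoc tU tR)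
    have 2: "trace (transpose K ** R ** E ** U) = trace (U ** transpose K ** R ** E)"
      using trace_mul_sym[of "transpose K ** R ** E" U] by (simp add: matrix_mul_assoc)
    have 3: "trace (Y ** B ** E ** U) = trace (U ** Y ** B ** E)"
      using trace_mul_sym[of "Y ** B ** E" U] by (simp add: matrix_mul_assoc)
    have 4: "trace (Y ** U ** transpose E ** transpose B) = trace (U ** Y ** B ** E)"
    proof -
      have "trace (Y ** U ** transpose E ** transpose B) = trace (B ** E ** (U ** Y))"
        using trace_transpose[of "B ** E ** (U ** Y)"] by (simp add: matrix_transpose_mul matrix_mul_assoc tU tY)
      also have "\<dots> = trace (U ** Y ** (B ** E))" by (rule trace_mul_sym)
      finally show ?thesis by (simp add: matrix_mul_assoc)
    qed
    have 5: "trace (Y ** U ** transpose E ** R ** K ** U) = trace (U ** Y ** U ** transpose K ** R ** E)"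
    proof -
      have "trace (Y ** U ** transpose E ** R ** K ** U) = trace (U ** transpose K ** R ** E ** (U ** Y))"
        using trace_transpose[of "U ** transpose K ** R ** E ** (U ** Y)"]
        by (simp add: matrix_transpose_mul matrix_mul_assoc tU tY tR)
      also have "\<dots> = trace (U ** Y ** (U ** transpose K ** R ** E))" by (rule trace_mul_sym)
      finally show ?thesis by (simp add: matrix_mul_assoc)
    qed
    have 6: "trace (Y ** U ** transpose K ** R ** E ** U) = trace (U ** Y ** U ** transpose K ** R ** E)"
      using trace_mul_sym[of "Y ** U ** transpose K ** R ** E" U] by (simp add: matrix_mul_assoc)
    show ?thesis
      unfolding d\<Phi>_def lyap_def by (simp add: matrix_ring trace_add 1 2 3 4 5 6 algebra_simps)
  qed
  ultimately have f: "(f has_derivative (\<lambda>E. 2 * \<beta>\<^sup>2 * trace (U ** (transpose K ** R + Y ** U ** transpose K ** R + Y ** B) ** E))) (at K)"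
    by simp
  obtain \<eta> where \<eta>: "(\<eta> \<longlongrightarrow> 0) (at K)"
    "\<forall>\<^sub>F K' in at K. norm (trace (SK K' ** u K') - trace (SK K ** U)
        - (trace ((SK K' - SK K) ** U) + trace (Y ** ric (AK K') (SK K') V U))) \<le> \<eta> K' * norm (ric (AK K') (SK K') V U)"
    using P.trace_expansion[OF u Y(2)] by blast
  obtain c where c: "c > 0" "\<forall>\<^sub>F K' in at K. norm (\<Phi> K') \<le> c * norm (K' - K)"
    using has_derivative_bounded_quotient[OF \<Phi> \<Phi>0] by blast
  show ?thesis
  proof (rule has_derivative_of_small_difference[OF f])
    show "((\<lambda>K'. \<beta>\<^sup>2 * (\<bar>\<eta> K'\<bar> * c)) \<longlongrightarrow> 0) (at K)"
      using \<eta>(1) by (intro tendsto_mult_right_zero tendsto_mult_left_zero tendsto_rabs_zero)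
    show "\<forall>\<^sub>F K' in at K. norm (J_mix A B Bw Q R \<beta> K' - J_mix A B Bw Q R \<beta> K - (f K' - f K))
        \<le> \<beta>\<^sup>2 * (\<bar>\<eta> K'\<bar> * c) * norm (K' - K)"
      using \<eta>(2) c(2) hur u
    proof eventually_elim
      case (elim K')
      define r where "r = trace (SK K' ** u K') - trace (SK K ** U)
        - (trace ((SK K' - SK K) ** U) + trace (Y ** \<Phi> K'))"
      have "J_mix A B Bw Q R \<beta> K' - J_mix A B Bw Q R \<beta> K - (f K' - f K) = \<beta>\<^sup>2 * r"
        unfolding J_mix_eq[OF elim(3,4)] J_mix_eq[OF h U] f_def r_def \<Phi>0
        by (simp add: matrix_ring trace_sub trace_0[unfolded mat_0] algebra_simps)
      also have "norm (\<beta>\<^sup>2 * r) = \<beta>\<^sup>2 * norm r" by (simp add: abs_mult)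
      also have "\<dots> \<le> \<beta>\<^sup>2 * (\<bar>\<eta> K'\<bar> * norm (\<Phi> K'))"
        using elim(1) mult_right_mono[OF abs_ge_self, of "norm (\<Phi> K')" "\<eta> K'"]
        by (intro mult_left_mono) (auto simp: r_def \<Phi>_def)
      also have "\<dots> \<le> \<beta>\<^sup>2 * (\<bar>\<eta> K'\<bar> * (c * norm (K' - K)))"
        using elim(2) by (intro mult_left_mono) auto
      finally show ?case by (simp add: mult.assoc)
    qed
  qed
qed

lemma stationary_iff:
  assumes K: "K \<in> K_beta A B Bw Q R \<beta>"
  obtains P where "stab_ric (transpose (AK K)) V (SK K) P"
    "stationary A B Bw Q R \<beta> K \<longleftrightarrow> K = - (Ri ** transpose B ** P)"
proof -
  have h: "hurwitz (AK K)" using K by (simp add: K_beta_def stab_set_def)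
  obtain X where "pos_def X" "pos_def (- ric (AK K) (SK K) V X)"
    using K_beta_strict[OF K] by blast
  then obtain U where U: "stab_ric (AK K) (SK K) V U"
    using stab_ric_exists[OF S sym(1)] pos_def_sym by blast
  have Up: "pos_def U" by (rule stab_ric_pos_def[OF h U])
  have hU: "hurwitz (transpose (AK K + U ** SK K))"
    using U by (simp add: stab_ric_def hurwitz_transpose)
  obtain Y where Y: "sym_mat Y" "lyap (transpose (AK K + U ** SK K)) Y = - SK K"
    using lyap_solve[OF hU, of "- SK K"] by auto
  have Yp: "pos_def Y"
    using lyap_inverse_pd[OF hU Y(1)] Y(2) S by simp
  define N where "N = matrix_inv Y + U"
  define P where "P = matrix_inv N"
  have N: "pos_def N" and P: "stab_ric (transpose (AK K)) V (SK K) P"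
    using stab_ric_dual[OF U pos_def_imp_pos_semidef[OF Up] Yp Y(2) sym(2)] by (simp_all add: N_def P_def)
  have tP: "transpose P = P" using P by (simp add: stab_ric_def sym_mat_def)
  note invN = pos_def_inverse[OF N, folded P_def]
  define G where "G = U ** (transpose K ** R + Y ** U ** transpose K ** R + Y ** B)"
  \<comment> \<open>Through this identity the bracket of the gradient factors as Y N (K^T R + P B),
    and every factor but the last is invertible.\<close>
  have YN: "Y ** N = mat 1 + Y ** U"
    by (simp add: N_def matrix_ring pos_def_inverse[OF Yp])
  have "Y ** N ** (transpose K ** R + P ** B) = Y ** N ** transpose K ** R + Y ** (N ** P) ** B"
    by (simp only: matrix_add_ldistrib matrix_mul_assoc)
  also have "\<dots> = transpose K ** R + Y ** U ** transpose K ** R + Y ** B"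
    unfolding YN invN(1) by (simp add: matrix_ring)
  finally have G: "G = U ** (Y ** (N ** (transpose K ** R + P ** B)))"
    by (simp add: G_def matrix_mul_assoc)
  have inj: "Z = 0" if "pos_def L" "L ** Z = 0" for L :: "real^'n^'n" and Z :: "real^'m^'n"
    using that pos_def_inverse(2)[OF that(1)] by (metis matrix_mul_assoc matrix_mul_lid times0_right)
  have der: "(J_mix A B Bw Q R \<beta> has_derivative (\<lambda>E. 2 * \<beta>\<^sup>2 * trace (G ** E))) (at K)"
    unfolding G_def by (rule J_mix_has_derivative[OF h U Y])
  have "stationary A B Bw Q R \<beta> K \<longleftrightarrow> (J_mix A B Bw Q R \<beta> has_derivative (\<lambda>_. 0)) (at K)"
    using K by (simp add: stationary_def)
  also have "\<dots> \<longleftrightarrow> (\<lambda>E. 2 * \<beta>\<^sup>2 * trace (G ** E)) = (\<lambda>_. 0)"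
    using der has_derivative_unique by metis
  also have "\<dots> \<longleftrightarrow> (\<forall>E. trace (G ** E) = 0)"
    using \<beta> by (simp add: fun_eq_iff)
  also have "\<dots> \<longleftrightarrow> G = 0"
    using trace_pairing_eq_0[of G] by (auto simp: trace_def)
  also have "\<dots> \<longleftrightarrow> transpose K ** R + P ** B = 0"
    unfolding G using inj[OF Up] inj[OF Yp] inj[OF N] by (metis times0_right)
  also have "\<dots> \<longleftrightarrow> R ** K + transpose B ** P = 0"
  proof -
    have "transpose (transpose K ** R + P ** B) = R ** K + transpose B ** P"
      by (simp add: matrix_ring tP tR)
    then show ?thesis by (metis transpose_iff transpose_zero)
  qed
  also have "\<dots> \<longleftrightarrow> K = - (Ri ** transpose B ** P)"
  proof
    assume "R ** K + transpose B ** P = 0"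
    then have "Ri ** (R ** K + transpose B ** P) = 0" by simp
    then show "K = - (Ri ** transpose B ** P)"
      by (simp add: matrix_ring Ri eq_neg_iff_add_eq_0)
  qed (simp add: matrix_ring Ri)
  finally show ?thesis using that P by blast
qed

lemma stab_ARE_sol_iff: "stab_ARE_sol A B Bw Q R \<beta> P \<longleftrightarrow> stab_ric (transpose A) M Q P"
proof (cases "sym_mat P")
  case True
  have "transpose (transpose A + P ** M) = A + M ** P"
    using True symM by (simp add: matrix_ring sym_mat_def)
  then have "hurwitz (A + M ** P) \<longleftrightarrow> hurwitz (transpose A + P ** M)"
    by (metis hurwitz_transpose)
  then show ?thesis
    using True by (simp add: stab_ARE_sol_def stab_ric_def ric_def lyap_def M_def V_def Ri_def Let_def)
qed (simp add: stab_ARE_sol_def stab_ric_def Let_def)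

end

section \<open>Existence and uniqueness of the stationary gain\<close>

theorem theorem5:
  fixes A Q Bw :: "real^'n^'n" and B :: "real^'m^'n" and R :: "real^'m^'m" and \<beta> :: real
  assumes "pos_def Q" and "pos_def R" and "\<beta> > 0"
    and "stabilizable A B"
    and "detectable (mat_sqrt Q) A"
    and "\<beta> > Inf (hinf_norm A B Bw Q R ` stab_set A B)"
    and "pos_def (Bw ** transpose Bw)"
  shows "(\<exists>P. stab_ARE_sol A B Bw Q R \<beta> P) \<and>
         (\<forall>P. stab_ARE_sol A B Bw Q R \<beta> P \<longrightarrow>
            (\<forall>K. stationary A B Bw Q R \<beta> K \<longleftrightarrow> K = - (matrix_inv R ** transpose B ** P)))"
proof -
  interpret mixed A Q Bw B R \<beta>
    using assms by unfold_locales
  have "stab_set A B \<noteq> {}"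
    using assms(4) by (auto simp: stabilizable_def stab_set_def closed_loop_def)
  then obtain K0 where "K0 \<in> stab_set A B" "hinf_norm A B Bw Q R K0 < \<beta>"
    using cInf_lessD[OF _ assms(6)] by blast
  then have "K0 \<in> K_beta A B Bw Q R \<beta>" by (simp add: K_beta_def)
  then obtain P where P: "pos_def P" "stab_ric (transpose A) M Q P"
    using ARE_solution_exists by blast
  define K where "K = - (Ri ** transpose B ** P)"
  have PK: "stab_ric (transpose (closed_loop A B K)) V (S_mat Q R K) P"
    using P(2) stab_ric_feedback[OF K_def] by blast
  have "K \<in> K_beta A B Bw Q R \<beta>"
    using K_beta_memI PK P(1) pos_def_imp_pos_semidef by blast
  then obtain P' where P': "stab_ric (transpose (closed_loop A B K)) V (S_mat Q R K) P'"
    "stationary A B Bw Q R \<beta> K \<longleftrightarrow> K = - (Ri ** transpose B ** P')"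
    by (rule stationary_iff)
  \<comment> \<open>The criterion yields a solution of the equation of \<open>K\<close> itself;
    since \<open>P\<close> solves the same equation, the fixed-point condition holds by the
    definition of \<open>K\<close>.\<close>
  have "P' = P" by (rule stab_ric_unique[OF sym(1) P'(1) PK])
  then have stat: "stationary A B Bw Q R \<beta> K"
    using P'(2) K_def by simp
  have uniq: "K' = K" if "stationary A B Bw Q R \<beta> K'" for K'
  proof -
    have "K' \<in> K_beta A B Bw Q R \<beta>" using that by (simp add: stationary_def)
    then obtain P'' where P'': "stab_ric (transpose (closed_loop A B K')) V (S_mat Q R K') P''"
      "stationary A B Bw Q R \<beta> K' \<longleftrightarrow> K' = - (Ri ** transpose B ** P'')"
      by (rule stationary_iff)
    then have K': "K' = - (Ri ** transpose B ** P'')" using that by blast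
    \<comment> \<open>At a stationary gain the square in the gain vanishes, so its own equation
      becomes the game equation, which has one stabilizing solution.\<close>
    then have "stab_ric (transpose A) M Q P''"
      using P''(1) stab_ric_feedback[OF K'] by blast
    then have "P'' = P" using P(2) stab_ric_unique[OF symM] by blast
    then show ?thesis using K' K_def by simp
  qed
  have "stationary A B Bw Q R \<beta> K' \<longleftrightarrow> K' = - (matrix_inv R ** transpose B ** P1)"
    if "stab_ARE_sol A B Bw Q R \<beta> P1" for P1 K'
  proof -
    have "P1 = P" using that P(2) stab_ric_unique[OF symM] unfolding stab_ARE_sol_iff by blast
    then show ?thesis using stat uniq unfolding K_def Ri_def by blast
  qed
  then show ?thesis using P(2) stab_ARE_sol_iff by blast
qed

end
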